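(* Let $(X_n)_{n\ge 0}$ be a homogeneous Markov chain with state space $E$, Markov operator $P$ and stationary probability measure $\nu$, and let $(\mathcal B,\|\cdot\|)$ be a Banach space of $\nu$-measurable functions from $E$ to $\mathbb R$ containing the constant function $\mathbf 1$. Suppose that the chain is $\mathcal B$-geometrically ergodic, with $p\ge 1$ an exponent for which $\mathcal B$ is continuously included in $\mathbb L^p(\nu)$, and let $q\in[1,\infty]$ be defined by $\frac1p+\frac1q=1$. Suppose also that there is a constant $M>0$ such that $\|fP^nf\|\le M\|f\|\,\|P^nf\|$ for all $f\in\mathcal B$ and all integers $n\ge 0$. Then there exists a constant $K$ (not depending on $\varphi$ or $n$) such that for all $\varphi\in\mathcal B$ with $\mathbb E_\nu(\varphi)=0$ and $\varphi\in\mathbb L^4(\nu)\cap\mathbb L^{3q}(\nu)$, and all $n\ge 1$, $$ \begin{aligned} \mathbb E_\nu\left[S_n(\varphi)^4\right]\le K\Big[\,& n\|\varphi(X_0)^4\|_1\log^3(\|\varphi\|+1)\\ &+n\left(\|\varphi(X_0)^3\|_q+\|\varphi(X_0)^2\|_q+\|\varphi(X_0)\|_q+\|\varphi(X_0)\|_q^2\right)\log^2(\|\varphi\|+1)\\ &+n^2\left(\|\varphi(X_0)^2\|_1\log(\|\varphi\|+1)+\|\varphi(X_0)\|_q\right)^2\Big], \end{aligned} $$ where $S_n(\varphi)=\sum_{i=1}^n\varphi(X_i)$.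
   Context: The chain is stationary: $\mathbb E_\nu$ denotes expectation when $X_0$ has distribution $\nu$; for a function $f$ on $E$, $\mathbb E_\nu(f)=\int f\,d\nu$. The Markov operator is $Pf(x)=\mathbb E(f(X_1)\mid X_0=x)$, and it acts on $\mathcal B$. For $r\in[1,\infty]$, $\|\cdot\|_r$ is the $\mathbb L^r(\nu)$ norm, so $\|\varphi(X_0)^j\|_r=\left(\int|\varphi|^{jr}d\nu\right)^{1/r}$ for $r<\infty$, with the essential supremum norm when $r=\infty$ (if $p=1$ then $q=\infty$ and $\mathbb L^{3q}=\mathbb L^\infty$). The notation $\|\cdot\|$ without subscript is the norm of $\mathcal B$, and $\log^k(x)=(\log x)^k$. Definition. The Markov chain $(X_n)_{n\ge0}$ is $\mathcal B$-geometrically ergodic (strongly ergodic with respect to $\mathcal B$) if: (a) there exist $\kappa>0$ and $0<\theta<1$ such that for all $f\in\mathcal B$ and all $n$, $\|P^nf-\Pi f\|\le\kappa\theta^n\|f\|$, where $\Pi f=\mathbb E_\nu(f)\mathbf 1$; (b) there exists $p\ge1$ such that $(\mathcal B,\|\cdot\|)$ is continuously included in $(\mathbb L^p(\nu),\|\cdot\|_p)$, i.e. there is $C>0$ with $\|f\|_p\le C\|f\|$ for all $f\in\mathcal B$. *)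

theory Defs
  imports "HOL-Probability.Probability"
begin

definition natural_filtration ::
  "'w measure \<Rightarrow> 'a measure \<Rightarrow> (nat \<Rightarrow> 'w \<Rightarrow> 'a) \<Rightarrow> nat \<Rightarrow> 'w measure" where
  "natural_filtration M E X n =
     sigma (space M) {X i -` A \<inter> space M | i A. i \<le> n \<and> A \<in> sets E}"

definition homogeneous_markov_chain ::
  "'w measure \<Rightarrow> 'a measure \<Rightarrow> ('a \<Rightarrow> 'a measure) \<Rightarrow> (nat \<Rightarrow> 'w \<Rightarrow> 'a) \<Rightarrow> bool" where
  "homogeneous_markov_chain M E \<kappa> X \<longleftrightarrow>
     prob_space M \<and> (\<forall>n. X n \<in> measurable M E) \<and> \<kappa> \<in> measurable E (prob_algebra E) \<and>
     (\<forall>n. \<forall>A \<in> sets E. AE \<omega> in M.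
        real_cond_exp M (natural_filtration M E X n) (\<lambda>\<omega>. indicator A (X (Suc n) \<omega>)) \<omega>
          = measure (\<kappa> (X n \<omega>)) A)"

definition stationary_distribution ::
  "'a measure \<Rightarrow> ('a \<Rightarrow> 'a measure) \<Rightarrow> 'a measure \<Rightarrow> bool" where
  "stationary_distribution E \<kappa> \<nu> \<longleftrightarrow>
     prob_space \<nu> \<and> sets \<nu> = sets E \<and> Giry_Monad.bind \<nu> \<kappa> = \<nu>"

text \<open>The kernel is the conditional law of \<open>X\<^sub>1\<close> given \<open>X\<^sub>0\<close>, so \<open>P f x\<close> is the conditional
  expectation of \<open>f X\<^sub>1\<close> given \<open>X\<^sub>0 = x\<close>.\<close>

definition markov_operator :: "('a \<Rightarrow> 'a measure) \<Rightarrow> ('a \<Rightarrow> real) \<Rightarrow> 'a \<Rightarrow> real" where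
  "markov_operator \<kappa> f = (\<lambda>x. \<integral>y. f y \<partial>\<kappa> x)"

text \<open>\<open>Lnorm\<close> is meaningful only for members of \<open>Lspace\<close>; the exponent ranges over
  the extended interval from 1 to \<open>\<infinity>\<close>.\<close>

definition Lspace :: "'a measure \<Rightarrow> ennreal \<Rightarrow> ('a \<Rightarrow> real) set" where
  "Lspace \<nu> r = {f \<in> borel_measurable \<nu>.
     if r = \<infinity> then esssup \<nu> (\<lambda>x. ennreal \<bar>f x\<bar>) < \<infinity>
     else integrable \<nu> (\<lambda>x. \<bar>f x\<bar> powr enn2real r)}"

definition Lnorm :: "'a measure \<Rightarrow> ennreal \<Rightarrow> ('a \<Rightarrow> real) \<Rightarrow> real" where
  "Lnorm \<nu> r f =
     (if r = \<infinity> then enn2real (esssup \<nu> (\<lambda>x. ennreal \<bar>f x\<bar>))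
      else (\<integral>x. \<bar>f x\<bar> powr enn2real r \<partial>\<nu>) powr (1 / enn2real r))"

text \<open>The space is a set of functions rather than a type. Definiteness of the norm is only
  required up to \<open>\<nu>\<close>-null sets: this admits both norms that separate points (e.g. Hoelder norms)
  and spaces of \<open>\<nu>\<close>-classes (e.g. functions of bounded variation), represented by the set
  of all their representatives.\<close>

definition banach_function_space ::
  "'a measure \<Rightarrow> ('a \<Rightarrow> real) set \<Rightarrow> (('a \<Rightarrow> real) \<Rightarrow> real) \<Rightarrow> bool" where
  "banach_function_space \<nu> B nrm \<longleftrightarrow>
     B \<subseteq> borel_measurable \<nu> \<and>
     (\<lambda>x. 0) \<in> B \<and>
     (\<forall>f\<in>B. \<forall>g\<in>B. (\<lambda>x. f x + g x) \<in> B) \<and>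
     (\<forall>c. \<forall>f\<in>B. (\<lambda>x. c * f x) \<in> B) \<and>
     (\<forall>f\<in>B. 0 \<le> nrm f) \<and>
     (\<forall>f\<in>B. nrm f = 0 \<longrightarrow> (AE x in \<nu>. f x = 0)) \<and>
     (\<forall>c. \<forall>f\<in>B. nrm (\<lambda>x. c * f x) = \<bar>c\<bar> * nrm f) \<and>
     (\<forall>f\<in>B. \<forall>g\<in>B. nrm (\<lambda>x. f x + g x) \<le> nrm f + nrm g) \<and>
     (\<forall>s :: nat \<Rightarrow> 'a \<Rightarrow> real.
        (\<forall>n. s n \<in> B) \<and>
        (\<forall>e>0. \<exists>N. \<forall>m\<ge>N. \<forall>n\<ge>N. nrm (\<lambda>x. s m x - s n x) < e) \<longrightarrow>
        (\<exists>f\<in>B. (\<lambda>n. nrm (\<lambda>x. s n x - f x)) \<longlonglongrightarrow> 0))"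

definition continuously_included ::
  "'a measure \<Rightarrow> ('a \<Rightarrow> real) set \<Rightarrow> (('a \<Rightarrow> real) \<Rightarrow> real) \<Rightarrow> ennreal \<Rightarrow> bool" where
  "continuously_included \<nu> B nrm p \<longleftrightarrow>
     B \<subseteq> Lspace \<nu> p \<and> (\<exists>C>0. \<forall>f\<in>B. Lnorm \<nu> p f \<le> C * nrm f)"

definition geometrically_ergodic ::
  "('a \<Rightarrow> 'a measure) \<Rightarrow> 'a measure \<Rightarrow> ('a \<Rightarrow> real) set \<Rightarrow> (('a \<Rightarrow> real) \<Rightarrow> real) \<Rightarrow> bool" where
  "geometrically_ergodic \<kappa> \<nu> B nrm \<longleftrightarrow>
     (\<exists>c>0. \<exists>\<theta>. 0 < \<theta> \<and> \<theta> < 1 \<and>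
        (\<forall>f\<in>B. \<forall>n. nrm (\<lambda>x. (markov_operator \<kappa> ^^ n) f x - (\<integral>y. f y \<partial>\<nu>)) \<le> c * \<theta> ^ n * nrm f)) \<and>
     (\<exists>p\<ge>1. continuously_included \<nu> B nrm p)"

end

(*
  Applied to n = 0, the multiplicative hypothesis and polarisation turn B into a normed algebra up to
  a constant, so the Markov property and the spectral gap can be used gap by gap. For a <= b <= c <= d
  this yields
    |E Y_a Y_b Y_c Y_d - cov(b - a) cov(d - c)| <= const ||phi||_q ||phi||^3 theta^(d - a),
  where Y_i = phi(X_i) and cov k is the covariance of Y_0 and Y_k, besides the trivial bound by
  ||phi^4||_1. The trivial bound is used for triples of gaps that are all below a cutoff N of order
  log(||phi|| + 1) with theta^N ||phi||^3 = O(log(||phi|| + 1)^2), and the geometric one otherwise; the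
  covariances are summed with the same cutoff.
*)
theory Submission
  imports Defs
begin

text \<open>The geometric estimate carries \<open>nrm \<phi> ^ 3\<close>, whereas the target
  tolerates only powers of \<open>ln (nrm \<phi> + 1)\<close>; the cutoff trades one for the other.
  Since these powers vanish with \<open>nrm \<phi>\<close>, the cutoff may not contain an additive
  constant, so small and large norms need different choices of \<open>N\<close>.

  The covariance product does not depend on the middle gap. Summing that gap and the largest index
  over at most \<open>n\<close> values each yields the \<open>n ^ 2\<close> term; the remainder is
  summed over all three gaps with a bound free of \<open>n\<close>, which leaves one factor
  \<open>n\<close>.

  Hoelder's inequality is applied only after conditioning has moved all later factors into one
  member of \<open>B\<close>, paired with the earliest value of \<phi>. Hence a single norm in
  \<open>L^q\<close> appears and the other three factors are measured in \<open>B\<close>. The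
  fourth moment makes the intermediate products integrable, so that conditioning is legitimate with
  unbounded factors.\<close>

section \<open>Hoelder's inequality and Lebesgue spaces\<close>

text \<open>\<open>Lspace\<close> and \<open>Lnorm\<close> change formula at \<infinity>, so the two
  endpoint pairs are split off. In between, the identity in \<open>ennreal\<close> becomes one
  between real exponents, as Young's inequality requires.\<close>

lemma conjugate_exponents_cases:
  fixes p q :: ennreal
  assumes "1 \<le> p" "1 \<le> q" "1 / p + 1 / q = 1"
  obtains "p = 1" "q = \<infinity>" | "p = \<infinity>" "q = 1"
    | p' q' where "p = ennreal p'" "q = ennreal q'" "1 < p'" "1 < q'" "1 / p' + 1 / q' = 1"
proof -
  have inv1: "r = 1" if "1 / r = 1" "1 \<le> r" for r :: ennreal
    using that by (cases r) (auto simp: divide_ennreal simp flip: ennreal_1)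
  consider "p = \<infinity>" | "q = \<infinity>" | "p \<noteq> \<infinity>" "q \<noteq> \<infinity>" by blast
  then show ?thesis
  proof cases
    case 1
    then show ?thesis using assms inv1[of q] that(2) by simp
  next
    case 2
    then show ?thesis using assms inv1[of p] that(1) by simp
  next
    case 3
    obtain p' q' where pq: "p = ennreal p'" "q = ennreal q'" "0 \<le> p'" "0 \<le> q'"
      using 3 by (cases p; cases q) auto
    have ge: "1 \<le> p'" "1 \<le> q'" using assms(1,2) pq by (auto simp flip: ennreal_1)
    have "ennreal (1 / p' + 1 / q') = ennreal 1"
      using assms(3) pq ge by (simp add: divide_ennreal flip: ennreal_1 ennreal_plus)
    then have eq: "1 / p' + 1 / q' = 1"
      using ge by (subst (asm) ennreal_inj) auto
    then have "p' \<noteq> 1" "q' \<noteq> 1" using ge by auto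
    then show ?thesis using that(3) pq ge eq by force
  qed
qed

text \<open>Integrability comes from Young's inequality applied pointwise, the estimate from the
  same inequality after both functions are scaled to norm 1. A vanishing norm forbids scaling, but
  then the product is zero almost everywhere.\<close>

lemma Holder_inequality:
  fixes p q :: real
  assumes pq: "1 < p" "1 < q" "1 / p + 1 / q = 1"
    and [measurable]: "f \<in> borel_measurable M" "g \<in> borel_measurable M"
    and f: "integrable M (\<lambda>x. \<bar>f x\<bar> powr p)" and g: "integrable M (\<lambda>x. \<bar>g x\<bar> powr q)"
  shows "integrable M (\<lambda>x. f x * g x :: real)"
    and "\<bar>\<integral>x. f x * g x \<partial>M\<bar> \<le> (\<integral>x. \<bar>f x\<bar> powr p \<partial>M) powr (1 / p) * (\<integral>x. \<bar>g x\<bar> powr q \<partial>M) powr (1 / q)"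
proof -
  show int: "integrable M (\<lambda>x. f x * g x)"
  proof (rule Bochner_Integration.integrable_bound[of _ "\<lambda>x. \<bar>f x\<bar> powr p / p + \<bar>g x\<bar> powr q / q"])
    show "AE x in M. norm (f x * g x) \<le> norm (\<bar>f x\<bar> powr p / p + \<bar>g x\<bar> powr q / q)"
      using Youngs_inequality[OF pq] pq by (intro AE_I2) (auto simp: abs_mult)
  qed (use f g in auto)
  define a where "a = (\<integral>x. \<bar>f x\<bar> powr p \<partial>M)"
  define b where "b = (\<integral>x. \<bar>g x\<bar> powr q \<partial>M)"
  have ab: "0 \<le> a" "0 \<le> b" by (auto simp: a_def b_def)
  show "\<bar>\<integral>x. f x * g x \<partial>M\<bar> \<le> (\<integral>x. \<bar>f x\<bar> powr p \<partial>M) powr (1 / p) * (\<integral>x. \<bar>g x\<bar> powr q \<partial>M) powr (1 / q)"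
  proof (cases "a = 0 \<or> b = 0")
    case True
    have "AE x in M. \<bar>f x\<bar> powr p = 0" if "a = 0"
      using that f by (subst integral_nonneg_eq_0_iff_AE[symmetric]) (auto simp: a_def)
    moreover have "AE x in M. \<bar>g x\<bar> powr q = 0" if "b = 0"
      using that g by (subst integral_nonneg_eq_0_iff_AE[symmetric]) (auto simp: b_def)
    ultimately have "AE x in M. f x * g x = 0" using True by auto
    then have "(\<integral>x. f x * g x \<partial>M) = 0" by (intro integral_eq_zero_AE)
    then show ?thesis by simp
  next
    case False
    with ab have pos: "0 < a" "0 < b" by auto
    define r where "r = a powr (1 / p)"
    define s where "s = b powr (1 / q)"
    have rs: "0 < r" "0 < s" "r powr p = a" "s powr q = b"
      using pos pq by (auto simp: r_def s_def powr_powr)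
    \<comment> \<open>Young's inequality for \<open>f / r\<close> and \<open>g / s\<close>; the
      right-hand side then integrates to \<open>1 / p + 1 / q = 1\<close>.\<close>
    have "\<bar>f x * g x\<bar> / (r * s) \<le> \<bar>f x\<bar> powr p / (a * p) + \<bar>g x\<bar> powr q / (b * q)" for x
      using Youngs_inequality[OF pq, of "\<bar>f x\<bar> / r" "\<bar>g x\<bar> / s"] rs
      by (simp add: abs_mult powr_divide)
    then have "(\<integral>x. \<bar>f x * g x\<bar> / (r * s) \<partial>M) \<le> (\<integral>x. \<bar>f x\<bar> powr p / (a * p) + \<bar>g x\<bar> powr q / (b * q) \<partial>M)"
      using int f g by (intro integral_mono) auto
    also have "\<dots> = a / (a * p) + b / (b * q)"
      using f g by (simp add: a_def b_def)
    also have "\<dots> = 1" using pos pq by simp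
    finally have "(\<integral>x. \<bar>f x * g x\<bar> \<partial>M) \<le> r * s"
      using rs by (simp add: divide_le_eq)
    with integral_abs_bound[of M "\<lambda>x. f x * g x"] show ?thesis
      unfolding r_def s_def a_def b_def by linarith
  qed
qed

lemma Lspace_measurable: "f \<in> Lspace M r \<Longrightarrow> f \<in> borel_measurable M"
  by (simp add: Lspace_def)

lemma Lnorm_nonneg: "0 \<le> Lnorm M r f"
  by (simp add: Lnorm_def)

text \<open>Membership in \<open>Lspace\<close> matters: \<open>enn2real\<close> sends \<infinity>
  to 0, so for an essentially unbounded function \<open>Lnorm\<close> would be 0 and the bound
  false.\<close>

lemma AE_abs_le_Lnorm_infinity:
  assumes "f \<in> Lspace M \<infinity>"
  shows "AE x in M. \<bar>f x\<bar> \<le> Lnorm M \<infinity> f"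
proof -
  have fin: "esssup M (\<lambda>x. ennreal \<bar>f x\<bar>) < \<infinity>"
    using assms by (simp add: Lspace_def)
  have "AE x in M. ennreal \<bar>f x\<bar> \<le> esssup M (\<lambda>x. ennreal \<bar>f x\<bar>)"
    by (rule esssup_AE)
  then show ?thesis
  proof eventually_elim
    case (elim x)
    then have "enn2real (ennreal \<bar>f x\<bar>) \<le> enn2real (esssup M (\<lambda>x. ennreal \<bar>f x\<bar>))"
      using fin by (intro enn2real_mono) auto
    then show ?case by (simp add: Lnorm_def)
  qed
qed

lemma Lspace_1: "f \<in> Lspace M 1 \<longleftrightarrow> integrable M f"
  using integrable_abs_cancel[of M f] by (auto simp: Lspace_def)

lemma Lnorm_1: "Lnorm M 1 f = (\<integral>x. \<bar>f x\<bar> \<partial>M)"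
  by (simp add: Lnorm_def)

lemma Holder_infinity_1:
  assumes f: "f \<in> Lspace M \<infinity>" and g: "g \<in> Lspace M 1"
  shows "integrable M (\<lambda>x. f x * g x)"
    and "\<bar>\<integral>x. f x * g x \<partial>M\<bar> \<le> Lnorm M \<infinity> f * Lnorm M 1 g"
proof -
  have [measurable]: "f \<in> borel_measurable M" "g \<in> borel_measurable M"
    using f g by (auto intro: Lspace_measurable)
  have gi: "integrable M g" using g by (simp add: Lspace_1)
  have ae: "AE x in M. \<bar>f x * g x\<bar> \<le> Lnorm M \<infinity> f * \<bar>g x\<bar>"
    using AE_abs_le_Lnorm_infinity[OF f] by eventually_elim (simp add: abs_mult mult_right_mono)
  show int: "integrable M (\<lambda>x. f x * g x)"
    by (rule Bochner_Integration.integrable_bound[of _ "\<lambda>x. Lnorm M \<infinity> f * \<bar>g x\<bar>"])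
      (use gi ae in \<open>auto simp: Lnorm_nonneg abs_mult\<close>)
  have "\<bar>\<integral>x. f x * g x \<partial>M\<bar> \<le> (\<integral>x. \<bar>f x * g x\<bar> \<partial>M)" by (rule integral_abs_bound)
  also have "\<dots> \<le> (\<integral>x. Lnorm M \<infinity> f * \<bar>g x\<bar> \<partial>M)"
    using int gi ae by (intro integral_mono_AE) auto
  finally show "\<bar>\<integral>x. f x * g x \<partial>M\<bar> \<le> Lnorm M \<infinity> f * Lnorm M 1 g"
    by (simp add: Lnorm_1)
qed

lemma Holder_Lnorm:
  assumes pq: "1 \<le> p" "1 \<le> q" "1 / p + 1 / q = 1"
    and f: "f \<in> Lspace M q" and g: "g \<in> Lspace M p"
  shows "integrable M (\<lambda>x. f x * g x) \<and> \<bar>\<integral>x. f x * g x \<partial>M\<bar> \<le> Lnorm M q f * Lnorm M p g"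
  using pq
proof (cases rule: conjugate_exponents_cases)
  case 1
  then show ?thesis using Holder_infinity_1[of f M g] f g by simp
next
  case 2
  then show ?thesis using Holder_infinity_1[of g M f] f g by (simp add: mult.commute)
next
  case (3 p' q')
  have "1 / q' + 1 / p' = 1" using 3 by simp
  from Holder_inequality[OF 3(4) 3(3) this, of f M g] show ?thesis
    using f g 3 by (simp add: Lspace_def Lnorm_def)
qed

text \<open>The dominating function is \<open>1 + \<bar>f\<bar> powr s\<close>: the 1 serves where
  \<open>\<bar>f\<bar> \<le> 1\<close> and is integrable by finiteness of the measure.\<close>

lemma (in finite_measure) integrable_powr_mono:
  assumes [measurable]: "f \<in> borel_measurable M"
    and int: "integrable M (\<lambda>x. \<bar>f x\<bar> powr s)" and rs: "0 \<le> r" "r \<le> s"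
  shows "integrable M (\<lambda>x. \<bar>f x :: real\<bar> powr r)"
proof (rule Bochner_Integration.integrable_bound[of _ "\<lambda>x. 1 + \<bar>f x\<bar> powr s"])
  have "\<bar>f x\<bar> powr r \<le> 1 + \<bar>f x\<bar> powr s" for x
  proof (cases "\<bar>f x\<bar> \<le> 1")
    case True
    then have "\<bar>f x\<bar> powr r \<le> 1" using rs by (simp add: powr_le1)
    then show ?thesis by (simp add: add_increasing2)
  next
    case False
    then have "\<bar>f x\<bar> powr r \<le> \<bar>f x\<bar> powr s" using rs by (intro powr_mono) auto
    then show ?thesis by simp
  qed
  then show "AE x in M. norm (\<bar>f x\<bar> powr r) \<le> norm (1 + \<bar>f x\<bar> powr s)" by simp
qed (use int in auto)

text \<open>Needed twice: to embed \<open>B\<close> into \<open>L^1\<close> through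
  \<open>L^p\<close>, and to pass from \<open>L^{3q}\<close> to \<open>L^q\<close>.\<close>

lemma (in finite_measure) Lspace_mono:
  assumes f: "f \<in> Lspace M s" and rs: "1 \<le> r" "r \<le> s"
  shows "f \<in> Lspace M r"
proof (cases "s = \<infinity>")
  case True
  have [measurable]: "f \<in> borel_measurable M" using f by (rule Lspace_measurable)
  have "integrable M (\<lambda>x. \<bar>f x\<bar> powr enn2real r)"
  proof (rule integrable_const_bound)
    show "AE x in M. norm (\<bar>f x\<bar> powr enn2real r) \<le> Lnorm M \<infinity> f powr enn2real r"
      using AE_abs_le_Lnorm_infinity[OF f[unfolded True]]
      by eventually_elim (auto intro!: powr_mono2)
  qed simp
  then show ?thesis using f True by (simp add: Lspace_def)
next
  case False
  then have "r < \<infinity>" using rs by (auto simp: top.not_eq_extremum)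
  then have "enn2real r \<le> enn2real s" using False rs by (intro enn2real_mono) (auto simp: top.not_eq_extremum)
  then show ?thesis
    using f False \<open>r < \<infinity>\<close> integrable_powr_mono[of f "enn2real s" "enn2real r"]
    by (auto simp: Lspace_def)
qed

section \<open>Sums over indices and geometric cutoffs\<close>

lemma ln_add_one_ge_half:
  fixes x :: real
  assumes "0 \<le> x" "x \<le> 1"
  shows "x / 2 \<le> ln (x + 1)"
proof -
  have "ln (1 / (x + 1)) \<le> 1 / (x + 1) - 1" using assms by (intro ln_le_minus_one) auto
  then have "1 - 1 / (x + 1) \<le> ln (x + 1)" using assms by (simp add: ln_div)
  moreover have "x / 2 \<le> 1 - 1 / (x + 1)"
  proof -
    have "1 - 1 / (x + 1) = x / (x + 1)" using assms by (simp add: field_simps)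
    also have "x / 2 \<le> x / (x + 1)" using assms by (intro divide_left_mono) auto
    finally show ?thesis .
  qed
  ultimately show ?thesis by linarith
qed

text \<open>For tiny \<epsilon> the first condition forces \<open>N = 0\<close>; this works for all
  \<open>\<epsilon> \<le> 1\<close> because \<open>\<epsilon> ^ 3 \<le> \<epsilon> ^ 2\<close> and
  the logarithm is comparable to \<epsilon> there. For \<open>\<epsilon> > 1\<close> the cutoff
  makes \<open>\<theta> ^ N\<close> at most \<open>1 / \<epsilon> ^ 3\<close>, and the 1 lost by
  rounding up is absorbed since \<open>ln (\<epsilon> + 1) \<ge> 1 / 2\<close>. The bound on
  \<open>\<epsilon> * \<theta> ^ N\<close> serves the sum of covariances, the cubic one the
  four-point remainder.\<close>

lemma geometric_cutoff:
  fixes \<theta> :: real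
  assumes \<theta>: "0 < \<theta>" "\<theta> < 1"
  obtains K where "0 < K" "\<And>\<epsilon>. 0 \<le> \<epsilon> \<Longrightarrow> \<exists>N::nat. real N \<le> K * ln (\<epsilon> + 1) \<and> \<epsilon> * \<theta> ^ N \<le> K
    \<and> \<epsilon> ^ 3 * \<theta> ^ N \<le> K * ln (\<epsilon> + 1) ^ 2"
proof
  define l where "l = - ln \<theta>"
  have l: "0 < l" using \<theta> by (simp add: l_def)
  \<comment> \<open>\<open>3 / l\<close> is the length of the cutoff per unit of
    \<open>ln \<epsilon>\<close>; the 4 pays for rounding up and is the square of the factor 2 from
    \<open>ln_add_one_ge_half\<close>.\<close>
  show "0 < 4 + 3 / l" using l by (simp add: add_pos_pos)
  fix \<epsilon> :: real assume \<epsilon>: "0 \<le> \<epsilon>"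
  show "\<exists>N::nat. real N \<le> (4 + 3 / l) * ln (\<epsilon> + 1) \<and> \<epsilon> * \<theta> ^ N \<le> 4 + 3 / l
    \<and> \<epsilon> ^ 3 * \<theta> ^ N \<le> (4 + 3 / l) * ln (\<epsilon> + 1) ^ 2"
  proof (cases "\<epsilon> \<le> 1")
    case True
    have "\<epsilon> ^ 3 \<le> \<epsilon> ^ 2" using \<epsilon> True by (intro power_decreasing) auto
    also have "\<epsilon> ^ 2 \<le> (2 * ln (\<epsilon> + 1)) ^ 2"
      using ln_add_one_ge_half[OF \<epsilon> True] \<epsilon> by (intro power_mono) auto
    also have "\<dots> \<le> (4 + 3 / l) * ln (\<epsilon> + 1) ^ 2"
      using l unfolding power_mult_distrib by (intro mult_right_mono) auto
    finally have "\<epsilon> ^ 3 \<le> (4 + 3 / l) * ln (\<epsilon> + 1) ^ 2" .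
    moreover have "\<epsilon> \<le> 4 + 3 / l" using True l by (intro order_trans[OF True]) auto
    ultimately show ?thesis using l \<epsilon> by (intro exI[of _ 0]) auto
  next
    case False
    \<comment> \<open>The solution of \<open>\<theta> powr t = 1 / \<epsilon> ^ 3\<close>.\<close>
    define t where "t = 3 * ln \<epsilon> / l"
    define N where "N = nat \<lceil>t\<rceil>"
    have ln0: "0 < ln \<epsilon>" using False by simp
    have t: "0 < t" using ln0 l by (simp add: t_def)
    have N: "t \<le> real N" "real N \<le> t + 1" using t by (auto simp: N_def)
    have half: "1 / 2 \<le> ln (\<epsilon> + 1)"
    proof -
      have "1 / 2 \<le> ln (1 + 1 :: real)" using ln_add_one_ge_half[of 1] by simp
      also have "\<dots> \<le> ln (\<epsilon> + 1)" using False by (subst ln_le_cancel_iff) auto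
      finally show ?thesis .
    qed
    have lnle: "ln \<epsilon> \<le> ln (\<epsilon> + 1)" using False by (subst ln_le_cancel_iff) auto
    have "real N \<le> 3 * ln \<epsilon> / l + 1" using N by (simp add: t_def)
    also have "\<dots> \<le> 3 * ln (\<epsilon> + 1) / l + 4 * ln (\<epsilon> + 1)"
      using lnle half l by (intro add_mono divide_right_mono) auto
    finally have 1: "real N \<le> (4 + 3 / l) * ln (\<epsilon> + 1)" by (simp add: algebra_simps)
    have "\<theta> ^ N = \<theta> powr real N" using \<theta> by (simp add: powr_realpow)
    also have "\<dots> \<le> \<theta> powr t" using \<theta> N by (intro powr_mono') auto
    also have "\<dots> = exp (- (3 * ln \<epsilon>))" using \<theta> l by (simp add: powr_def t_def l_def)
    also have "\<dots> = 1 / \<epsilon> ^ 3"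
    proof -
      have "exp (3 * ln \<epsilon>) = \<epsilon> ^ 3"
        using False exp_of_nat_mult[of 3 "ln \<epsilon>"] by simp
      then show ?thesis by (simp add: exp_minus field_simps)
    qed
    finally have le: "\<epsilon> ^ 3 * \<theta> ^ N \<le> 1" using False by (simp add: field_simps)
    have "1 \<le> 4 * ln (\<epsilon> + 1) ^ 2" using power_mono[OF half, of 2] by (simp add: power2_eq_square)
    also have "\<dots> \<le> (4 + 3 / l) * ln (\<epsilon> + 1) ^ 2" using l by (intro mult_right_mono) auto
    finally have 2: "\<epsilon> ^ 3 * \<theta> ^ N \<le> (4 + 3 / l) * ln (\<epsilon> + 1) ^ 2" using le by linarith
    have "\<epsilon> ^ 1 \<le> \<epsilon> ^ 3" using False by (intro power_increasing) auto
    then have "\<epsilon> * \<theta> ^ N \<le> \<epsilon> ^ 3 * \<theta> ^ N" using \<theta> by (intro mult_right_mono) auto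
    also have "\<dots> \<le> 1" by (rule le)
    also have "\<dots> \<le> 4 + 3 / l" using l by (simp add: add_increasing2)
    finally show ?thesis using 1 2 by blast
  qed
qed

section \<open>Reduction of symmetric sums to ordered indices\<close>

lemma sum_le_2_sum_ordered:
  fixes G :: "nat \<Rightarrow> nat \<Rightarrow> real"
  assumes nonneg: "\<And>a b. 0 \<le> G a b" and sym: "\<And>a b. G a b = G b a"
  shows "(\<Sum>a=1..n. \<Sum>b=1..n. G a b) \<le> 2 * (\<Sum>b=1..n. \<Sum>a=1..b. G a b)"
proof -
  define R where "R a b = (if a \<le> b then G a b else 0)" for a b
  have "(\<Sum>a=1..n. \<Sum>b=1..n. G a b) \<le> (\<Sum>a=1..n. \<Sum>b=1..n. R a b + R b a)"
    using nonneg sym by (intro sum_mono) (auto simp: R_def)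
  also have "\<dots> = 2 * (\<Sum>b=1..n. \<Sum>a=1..n. R a b)"
    using sum.swap[of R "{1..n}" "{1..n}"] by (simp add: sum.distrib)
  also have "(\<Sum>b=1..n. \<Sum>a=1..n. R a b) = (\<Sum>b=1..n. \<Sum>a=1..b. G a b)"
    by (intro sum.cong refl sum.mono_neutral_cong_right) (auto simp: R_def)
  finally show ?thesis .
qed

text \<open>The transposition of the outer indices as a composition of three adjacent ones.\<close>

lemma sum3_swap_ends:
  fixes R :: "nat \<Rightarrow> nat \<Rightarrow> nat \<Rightarrow> real"
  shows "(\<Sum>a\<in>I. \<Sum>b\<in>I. \<Sum>c\<in>I. R c b a) = (\<Sum>a\<in>I. \<Sum>b\<in>I. \<Sum>c\<in>I. R a b c)"
proof -
  have "(\<Sum>a\<in>I. \<Sum>b\<in>I. \<Sum>c\<in>I. R c b a) = (\<Sum>b\<in>I. \<Sum>a\<in>I. \<Sum>c\<in>I. R c b a)"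
    by (rule sum.swap)
  also have "\<dots> = (\<Sum>b\<in>I. \<Sum>c\<in>I. \<Sum>a\<in>I. R c b a)"
    by (intro sum.cong refl sum.swap)
  also have "\<dots> = (\<Sum>c\<in>I. \<Sum>b\<in>I. \<Sum>a\<in>I. R c b a)"
    by (rule sum.swap)
  finally show ?thesis .
qed

text \<open>Some index is largest, and symmetry moves it to the last place. Ties are counted
  repeatedly, which nonnegativity turns into an inequality.\<close>

lemma sum_le_3_sum_max_last:
  fixes G :: "nat \<Rightarrow> nat \<Rightarrow> nat \<Rightarrow> real"
  assumes nonneg: "\<And>a b c. 0 \<le> G a b c"
    and sym: "\<And>a b c. G a b c = G b a c" "\<And>a b c. G a b c = G a c b"
  shows "(\<Sum>a=1..n. \<Sum>b=1..n. \<Sum>c=1..n. G a b c) \<le> 3 * (\<Sum>c=1..n. \<Sum>b=1..c. \<Sum>a=1..c. G a b c)"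
proof -
  let ?I = "{1..n}"
  define R where "R a b c = (if a \<le> c \<and> b \<le> c then G a b c else 0)" for a b c
  have le: "G a b c \<le> R a b c + R a c b + R c b a" for a b c
  proof -
    have "G a c b = G a b c" "G c b a = G a b c" using sym by metis+
    then show ?thesis using nonneg[of a b c] unfolding R_def by auto
  qed
  have "(\<Sum>a\<in>?I. \<Sum>b\<in>?I. \<Sum>c\<in>?I. G a b c) \<le> (\<Sum>a\<in>?I. \<Sum>b\<in>?I. \<Sum>c\<in>?I. R a b c + R a c b + R c b a)"
    by (intro sum_mono le)
  also have "\<dots> = (\<Sum>a\<in>?I. \<Sum>b\<in>?I. \<Sum>c\<in>?I. R a b c) + (\<Sum>a\<in>?I. \<Sum>b\<in>?I. \<Sum>c\<in>?I. R a c b)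
      + (\<Sum>a\<in>?I. \<Sum>b\<in>?I. \<Sum>c\<in>?I. R c b a)"
    by (simp add: sum.distrib)
  also have "(\<Sum>a\<in>?I. \<Sum>b\<in>?I. \<Sum>c\<in>?I. R a c b) = (\<Sum>a\<in>?I. \<Sum>b\<in>?I. \<Sum>c\<in>?I. R a b c)"
    by (intro sum.cong refl sum.swap)
  also have "(\<Sum>a\<in>?I. \<Sum>b\<in>?I. \<Sum>c\<in>?I. R c b a) = (\<Sum>a\<in>?I. \<Sum>b\<in>?I. \<Sum>c\<in>?I. R a b c)"
    by (rule sum3_swap_ends)
  also have "(\<Sum>a\<in>?I. \<Sum>b\<in>?I. \<Sum>c\<in>?I. R a b c) = (\<Sum>c\<in>?I. \<Sum>b\<in>?I. \<Sum>a\<in>?I. R a b c)"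
    by (rule sum3_swap_ends[symmetric])
  also have "\<dots> = (\<Sum>c=1..n. \<Sum>b=1..c. \<Sum>a=1..c. G a b c)"
  proof (rule sum.cong[OF refl])
    fix c assume c: "c \<in> ?I"
    then have "(\<Sum>a\<in>?I. R a b c) = (if b \<le> c then \<Sum>a=1..c. G a b c else 0)" for b
      by (auto simp: R_def intro!: sum.mono_neutral_cong_right)
    then show "(\<Sum>b\<in>?I. \<Sum>a\<in>?I. R a b c) = (\<Sum>b=1..c. \<Sum>a=1..c. G a b c)"
      using c by (auto intro!: sum.mono_neutral_cong_right)
  qed
  finally show ?thesis by simp
qed

lemma sum_le_4_sum_max_last:
  fixes G :: "nat \<Rightarrow> nat \<Rightarrow> nat \<Rightarrow> nat \<Rightarrow> real"
  assumes nonneg: "\<And>a b c d. 0 \<le> G a b c d"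
    and sym: "\<And>a b c d. G a b c d = G b a c d" "\<And>a b c d. G a b c d = G a c b d"
      "\<And>a b c d. G a b c d = G a b d c"
  shows "(\<Sum>a=1..n. \<Sum>b=1..n. \<Sum>c=1..n. \<Sum>d=1..n. G a b c d)
    \<le> 4 * (\<Sum>d=1..n. \<Sum>a=1..d. \<Sum>b=1..d. \<Sum>c=1..d. G a b c d)"
proof -
  let ?I = "{1..n}"
  let ?S = "\<lambda>R :: nat \<Rightarrow> nat \<Rightarrow> nat \<Rightarrow> nat \<Rightarrow> real. \<Sum>a\<in>?I. \<Sum>b\<in>?I. \<Sum>c\<in>?I. \<Sum>d\<in>?I. R a b c d"
  define R where "R a b c d = (if a \<le> d \<and> b \<le> d \<and> c \<le> d then G a b c d else 0)" for a b c d
  have le: "G a b c d \<le> R a b c d + R a b d c + R a d c b + R d b c a" for a b c d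
  proof -
    have eq: "G a b d c = G a b c d" "G a d c b = G a b c d" "G d b c a = G a b c d" using sym by metis+
    have "\<exists>m\<in>{a, b, c, d}. a \<le> m \<and> b \<le> m \<and> c \<le> m \<and> d \<le> m"
      by (intro bexI[of _ "Max {a, b, c, d}"] conjI Max_ge Max_in) auto
    then show ?thesis using nonneg[of a b c d] unfolding R_def eq by auto
  qed
  have "?S G \<le> ?S (\<lambda>a b c d. R a b c d + R a b d c + R a d c b + R d b c a)"
    by (intro sum_mono le)
  also have "\<dots> = ?S R + ?S (\<lambda>a b c d. R a b d c) + ?S (\<lambda>a b c d. R a d c b) + ?S (\<lambda>a b c d. R d b c a)"
    by (simp add: sum.distrib)
  also have "?S (\<lambda>a b c d. R a b d c) = ?S R"
    by (intro sum.cong refl sum.swap)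
  also have "?S (\<lambda>a b c d. R a d c b) = ?S R"
    by (intro sum.cong refl sum3_swap_ends)
  also have "?S (\<lambda>a b c d. R d b c a) = ?S R"
  proof -
    have "?S (\<lambda>a b c d. R d b c a) = (\<Sum>b\<in>?I. \<Sum>a\<in>?I. \<Sum>c\<in>?I. \<Sum>d\<in>?I. R d b c a)"
      by (rule sum.swap)
    also have "\<dots> = (\<Sum>b\<in>?I. \<Sum>a\<in>?I. \<Sum>c\<in>?I. \<Sum>d\<in>?I. R a b c d)"
      by (intro sum.cong refl sum3_swap_ends)
    also have "\<dots> = ?S R" by (rule sum.swap)
    finally show ?thesis .
  qed
  also have "?S R = (\<Sum>d\<in>?I. \<Sum>a\<in>?I. \<Sum>b\<in>?I. \<Sum>c\<in>?I. R a b c d)"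
  proof -
    have "?S R = (\<Sum>a\<in>?I. \<Sum>b\<in>?I. \<Sum>d\<in>?I. \<Sum>c\<in>?I. R a b c d)"
      by (intro sum.cong refl sum.swap)
    also have "\<dots> = (\<Sum>a\<in>?I. \<Sum>d\<in>?I. \<Sum>b\<in>?I. \<Sum>c\<in>?I. R a b c d)"
      by (intro sum.cong refl sum.swap)
    also have "\<dots> = (\<Sum>d\<in>?I. \<Sum>a\<in>?I. \<Sum>b\<in>?I. \<Sum>c\<in>?I. R a b c d)"
      by (rule sum.swap)
    finally show ?thesis .
  qed
  also have "\<dots> = (\<Sum>d=1..n. \<Sum>a=1..d. \<Sum>b=1..d. \<Sum>c=1..d. G a b c d)"
  proof (rule sum.cong[OF refl])
    fix d assume d: "d \<in> ?I"
    then have 1: "(\<Sum>c\<in>?I. R a b c d) = (if a \<le> d \<and> b \<le> d then \<Sum>c=1..d. G a b c d else 0)" for a b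
      by (auto simp: R_def intro!: sum.mono_neutral_cong_right)
    have 2: "(\<Sum>b\<in>?I. \<Sum>c\<in>?I. R a b c d) = (if a \<le> d then \<Sum>b=1..d. \<Sum>c=1..d. G a b c d else 0)" for a
      unfolding 1 using d by (auto intro!: sum.mono_neutral_cong_right)
    show "(\<Sum>a\<in>?I. \<Sum>b\<in>?I. \<Sum>c\<in>?I. R a b c d) = (\<Sum>a=1..d. \<Sum>b=1..d. \<Sum>c=1..d. G a b c d)"
      unfolding 2 using d by (auto intro!: sum.mono_neutral_cong_right)
  qed
  finally show ?thesis by simp
qed

text \<open>Peeling off the largest index, then the largest of the remaining three, then ordering
  the last pair costs \<open>4 * 3 * 2 = 24\<close>, the number of orderings of four
  indices.\<close>

lemma sum_le_24_sum_ordered: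
  fixes G :: "nat \<Rightarrow> nat \<Rightarrow> nat \<Rightarrow> nat \<Rightarrow> real"
  assumes nonneg: "\<And>a b c d. 0 \<le> G a b c d"
    and sym: "\<And>a b c d. G a b c d = G b a c d" "\<And>a b c d. G a b c d = G a c b d"
      "\<And>a b c d. G a b c d = G a b d c"
  shows "(\<Sum>a=1..n. \<Sum>b=1..n. \<Sum>c=1..n. \<Sum>d=1..n. G a b c d)
    \<le> 24 * (\<Sum>d=1..n. \<Sum>c=1..d. \<Sum>b=1..c. \<Sum>a=1..b. G a b c d)"
proof -
  have "(\<Sum>d=1..n. \<Sum>a=1..d. \<Sum>b=1..d. \<Sum>c=1..d. G a b c d)
      \<le> (\<Sum>d=1..n. 3 * (\<Sum>c=1..d. \<Sum>b=1..c. \<Sum>a=1..c. G a b c d))"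
    by (intro sum_mono sum_le_3_sum_max_last assms)
  also have "\<dots> \<le> (\<Sum>d=1..n. 3 * (\<Sum>c=1..d. 2 * (\<Sum>b=1..c. \<Sum>a=1..b. G a b c d)))"
  proof (intro sum_mono mult_left_mono)
    fix d c
    have "(\<Sum>b=1..c. \<Sum>a=1..c. G a b c d) = (\<Sum>a=1..c. \<Sum>b=1..c. G a b c d)"
      by (rule sum.swap)
    also have "\<dots> \<le> 2 * (\<Sum>b=1..c. \<Sum>a=1..b. G a b c d)"
      by (intro sum_le_2_sum_ordered assms)
    finally show "(\<Sum>b=1..c. \<Sum>a=1..c. G a b c d) \<le> 2 * (\<Sum>b=1..c. \<Sum>a=1..b. G a b c d)" .
  qed simp
  also have "\<dots> = 6 * (\<Sum>d=1..n. \<Sum>c=1..d. \<Sum>b=1..c. \<Sum>a=1..b. G a b c d)"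
    by (simp add: sum_distrib_left mult.assoc)
  finally show ?thesis using sum_le_4_sum_max_last[of G n] assms by force
qed

section \<open>Sums over gaps and truncated geometric sums\<close>

lemma sum_diff_le:
  fixes u :: "nat \<Rightarrow> real"
  assumes "b \<le> n" "\<And>i. 0 \<le> u i"
  shows "(\<Sum>a=1..b. u (b - a)) \<le> (\<Sum>i<n. u i)"
proof -
  have "(\<Sum>a=1..b. u (b - a)) = (\<Sum>i<b. u i)"
    by (intro sum.reindex_bij_witness[of _ "\<lambda>i. b - i" "\<lambda>a. b - a"]) auto
  also have "\<dots> \<le> (\<Sum>i<n. u i)" using assms by (intro sum_mono2) auto
  finally show ?thesis .
qed

text \<open>Working from the inside out, each index is replaced by its gap to the next one, and the
  range of the gap is enlarged to \<open>{..<n}\<close>. Only the largest index remains free, whence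
  the factor \<open>n\<close>.\<close>

lemma sum_gaps_le:
  fixes H :: "nat \<Rightarrow> nat \<Rightarrow> nat \<Rightarrow> real"
  assumes nonneg: "\<And>i j k. 0 \<le> H i j k"
  shows "(\<Sum>d=1..n. \<Sum>c=1..d. \<Sum>b=1..c. \<Sum>a=1..b. H (b - a) (c - b) (d - c))
    \<le> real n * (\<Sum>k<n. \<Sum>j<n. \<Sum>i<n. H i j k)"
proof -
  have "(\<Sum>d=1..n. \<Sum>c=1..d. \<Sum>b=1..c. \<Sum>a=1..b. H (b - a) (c - b) (d - c))
      \<le> (\<Sum>d=1..n. \<Sum>c=1..d. \<Sum>b=1..c. \<Sum>i<n. H i (c - b) (d - c))"
    by (intro sum_mono sum_diff_le nonneg) auto
  also have "\<dots> \<le> (\<Sum>d=1..n. \<Sum>c=1..d. \<Sum>j<n. \<Sum>i<n. H i j (d - c))"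
    by (intro sum_mono sum_diff_le[where u = "\<lambda>j. \<Sum>i<n. H i j _"] sum_nonneg nonneg) auto
  also have "\<dots> \<le> (\<Sum>d=1..n. \<Sum>k<n. \<Sum>j<n. \<Sum>i<n. H i j k)"
    by (intro sum_mono sum_diff_le[where u = "\<lambda>k. \<Sum>j<n. \<Sum>i<n. H i j k"] sum_nonneg nonneg) auto
  finally show ?thesis by simp
qed

lemma sum_geometric_le:
  fixes \<theta> :: real
  assumes "0 < \<theta>" "\<theta> < 1"
  shows "(\<Sum>i<n. \<theta> ^ i) \<le> 1 / (1 - \<theta>)"
  using assms by (simp add: sum_gp_strict divide_right_mono)

lemma sum_geometric_tail_le:
  fixes \<theta> :: real
  assumes "0 < \<theta>" "\<theta> < 1"
  shows "(\<Sum>i<n. if i < N then 0 else \<theta> ^ i) \<le> \<theta> ^ N / (1 - \<theta>)"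
proof -
  \<comment> \<open>Enlarging the range to \<open>N + n\<close> leaves exactly \<open>n\<close>
    nonzero terms after the shift by \<open>N\<close>, with no case distinction between
    \<open>n < N\<close> and \<open>N \<le> n\<close>.\<close>
  have "(\<Sum>i<n. if i < N then 0 else \<theta> ^ i) \<le> (\<Sum>i<N + n. if i < N then 0 else \<theta> ^ i)"
    using assms by (intro sum_mono2) auto
  also have "\<dots> = (\<Sum>i\<in>{N..<N + n}. \<theta> ^ i)"
    by (intro sum.mono_neutral_cong_right) auto
  also have "\<dots> = \<theta> ^ N * (\<Sum>i<n. \<theta> ^ i)"
    unfolding sum_distrib_left
    by (intro sum.reindex_bij_witness[of _ "\<lambda>i. N + i" "\<lambda>i. i - N"]) (auto simp flip: power_add)
  also have "\<dots> \<le> \<theta> ^ N * (1 / (1 - \<theta>))"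
    using assms sum_geometric_le[OF assms, of n] by (intro mult_left_mono) auto
  finally show ?thesis by simp
qed

lemma sum_truncated_const_le:
  fixes A :: real
  assumes "0 \<le> A"
  shows "(\<Sum>i<n. if i < N then A else 0) \<le> real N * A"
proof -
  have "(\<Sum>i<n. if i < N then A else 0) = (\<Sum>i<min n N. A)"
    by (intro sum.mono_neutral_cong_right) auto
  also have "\<dots> \<le> real N * A" using assms by (simp add: mult_right_mono)
  finally show ?thesis .
qed

lemma sum_truncated_geometric_le:
  fixes \<theta> A B :: real
  assumes \<theta>: "0 < \<theta>" "\<theta> < 1" and AB: "0 \<le> A" "0 \<le> B"
  shows "(\<Sum>i<n. if i < N then A else B * \<theta> ^ i) \<le> real N * A + B * \<theta> ^ N / (1 - \<theta>)"
proof -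
  have "(\<Sum>i<n. if i < N then A else B * \<theta> ^ i) = (\<Sum>i<n. if i < N then A else 0) + B * (\<Sum>i<n. if i < N then 0 else \<theta> ^ i)"
    unfolding sum_distrib_left sum.distrib[symmetric] by (intro sum.cong) auto
  also have "(\<Sum>i<n. if i < N then A else 0) \<le> real N * A"
    using AB by (intro sum_truncated_const_le)
  also have "(\<Sum>i<n. if i < N then 0 else \<theta> ^ i) \<le> \<theta> ^ N / (1 - \<theta>)"
    by (rule sum_geometric_tail_le[OF \<theta>])
  finally show ?thesis using AB by (simp add: mult_left_mono)
qed

text \<open>If the triple is not below the cutoff, some gap is at least \<open>N\<close>, so the
  geometric term is dominated by a sum of three products in which one factor is a tail. The sums
  then factor into one-dimensional ones, each tail contributing \<open>\<theta> ^ N\<close>; this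
  explains the 3 and the cube of \<open>1 - \<theta>\<close>.\<close>

lemma sum3_truncated_geometric_le:
  fixes \<theta> A B :: real
  assumes \<theta>: "0 < \<theta>" "\<theta> < 1" and AB: "0 \<le> A" "0 \<le> B"
  shows "(\<Sum>k<n. \<Sum>j<n. \<Sum>i<n. if i < N \<and> j < N \<and> k < N then A else B * \<theta> ^ (i + j + k))
    \<le> real N ^ 3 * A + 3 * B * \<theta> ^ N / (1 - \<theta>) ^ 3"
proof -
  define g where "g i = \<theta> ^ i" for i
  define s where "s i = (if i < N then 1 else 0 :: real)" for i
  define t where "t i = (if i < N then 0 else \<theta> ^ i)" for i
  define \<Gamma> where "\<Gamma> = 1 / (1 - \<theta>)"
  have nn: "0 \<le> g i" "0 \<le> s i" "0 \<le> t i" for i using \<theta> by (auto simp: g_def s_def t_def)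
  have \<Gamma>: "0 < \<Gamma>" using \<theta> by (simp add: \<Gamma>_def)
  have le: "(if i < N \<and> j < N \<and> k < N then A else B * \<theta> ^ (i + j + k))
      \<le> A * (s k * s j * s i) + B * (t k * g j * g i) + B * (g k * t j * g i) + B * (g k * g j * t i)" for i j k
  proof (cases "i < N \<and> j < N \<and> k < N")
    case True
    then show ?thesis using AB nn by (simp add: s_def t_def)
  next
    case False
    have "B * \<theta> ^ (i + j + k) = B * (g k * g j * g i)"
      by (simp add: g_def power_add mult_ac)
    moreover have "t i = g i \<or> t j = g j \<or> t k = g k" using False by (auto simp: t_def g_def)
    moreover have "0 \<le> A * (s k * s j * s i)" "0 \<le> B * (t k * g j * g i)"
      "0 \<le> B * (g k * t j * g i)" "0 \<le> B * (g k * g j * t i)"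
      using AB nn by auto
    ultimately show ?thesis using False by auto
  qed
  have prod: "(\<Sum>k<n. \<Sum>j<n. \<Sum>i<n. x k * y j * z i) = (\<Sum>k<n. x k) * (\<Sum>j<n. y j) * (\<Sum>i<n. z i)"
    for x y z :: "nat \<Rightarrow> real"
    by (simp only: sum_distrib_left[symmetric] sum_distrib_right[symmetric])
  have S: "(\<Sum>i<n. s i) \<le> real N" "0 \<le> (\<Sum>i<n. s i)"
    using sum_truncated_const_le[of 1 N n] by (simp_all add: s_def sum_nonneg nn[unfolded s_def])
  have G: "(\<Sum>i<n. g i) \<le> \<Gamma>" "0 \<le> (\<Sum>i<n. g i)"
    using sum_geometric_le[OF \<theta>] by (simp_all add: g_def \<Gamma>_def sum_nonneg nn[unfolded g_def])
  have T: "(\<Sum>i<n. t i) \<le> \<theta> ^ N * \<Gamma>" "0 \<le> (\<Sum>i<n. t i)"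
    using sum_geometric_tail_le[OF \<theta>] by (simp_all add: t_def \<Gamma>_def sum_nonneg nn[unfolded t_def])
  have "(\<Sum>k<n. \<Sum>j<n. \<Sum>i<n. if i < N \<and> j < N \<and> k < N then A else B * \<theta> ^ (i + j + k))
    \<le> (\<Sum>k<n. \<Sum>j<n. \<Sum>i<n. A * (s k * s j * s i) + B * (t k * g j * g i) + B * (g k * t j * g i) + B * (g k * g j * t i))"
    by (intro sum_mono le)
  also have "\<dots> = A * ((\<Sum>i<n. s i) * (\<Sum>i<n. s i) * (\<Sum>i<n. s i)) + B * ((\<Sum>i<n. t i) * (\<Sum>i<n. g i) * (\<Sum>i<n. g i))
      + B * ((\<Sum>i<n. g i) * (\<Sum>i<n. t i) * (\<Sum>i<n. g i)) + B * ((\<Sum>i<n. g i) * (\<Sum>i<n. g i) * (\<Sum>i<n. t i))"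
    by (simp only: sum.distrib sum_distrib_left[symmetric, of A] sum_distrib_left[symmetric, of B] prod)
  also have "\<dots> \<le> A * (real N * real N * real N) + B * ((\<theta> ^ N * \<Gamma>) * \<Gamma> * \<Gamma>)
      + B * (\<Gamma> * (\<theta> ^ N * \<Gamma>) * \<Gamma>) + B * (\<Gamma> * \<Gamma> * (\<theta> ^ N * \<Gamma>))"
    using AB S G T \<Gamma> \<theta> by (intro add_mono mult_left_mono mult_mono mult_nonneg_nonneg) auto
  also have "\<dots> = real N ^ 3 * A + 3 * B * \<theta> ^ N * \<Gamma> ^ 3"
    by (simp add: power3_eq_cube)
  finally show ?thesis by (simp add: \<Gamma>_def power_divide)
qed

section \<open>The Markov property\<close>

locale stationary_chain =
  fixes M :: "'w measure" and E :: "'a measure" and \<kappa> :: "'a \<Rightarrow> 'a measure"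
    and X :: "nat \<Rightarrow> 'w \<Rightarrow> 'a" and \<nu> :: "'a measure"
  assumes chain: "homogeneous_markov_chain M E \<kappa> X"
    and stationary: "stationary_distribution E \<kappa> \<nu>"
    and initial: "distr M E (X 0) = \<nu>"
begin

abbreviation "P \<equiv> markov_operator \<kappa>"
abbreviation "F \<equiv> natural_filtration M E X"

sublocale prob_space M
  using chain unfolding homogeneous_markov_chain_def by auto

sublocale \<nu>: prob_space \<nu>
  using stationary unfolding stationary_distribution_def by auto

lemma sets_\<nu> [measurable_cong]: "sets \<nu> = sets E"
  using stationary unfolding stationary_distribution_def by auto

lemma X_measurable [measurable]: "X n \<in> measurable M E"
  using chain unfolding homogeneous_markov_chain_def by auto

lemma kernel_measurable: "\<kappa> \<in> measurable E (prob_algebra E)"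
  using chain unfolding homogeneous_markov_chain_def by auto

lemma kernel_measurable' [measurable]: "\<kappa> \<in> measurable E (subprob_algebra E)"
  using kernel_measurable by (rule measurable_prob_algebraD)

lemma kernel:
  assumes "x \<in> space E"
  shows "prob_space (\<kappa> x)" and "sets (\<kappa> x) = sets E"
  using measurable_space[OF kernel_measurable assms] by (auto simp: space_prob_algebra)

lemma space_F: "space (F n) = space M"
  unfolding natural_filtration_def by (rule space_measure_of) auto

lemma sets_F: "sets (F n) = sigma_sets (space M) {X i -` A \<inter> space M | i A. i \<le> n \<and> A \<in> sets E}"
  unfolding natural_filtration_def by (rule sets_measure_of) auto

lemma subalgebra_F: "subalgebra M (F n)"
proof -
  have "sets (F n) \<subseteq> sets M"
    unfolding sets_F by (rule sets.sigma_sets_subset) auto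
  then show ?thesis by (simp add: subalgebra_def space_F)
qed

lemma F_mono: "m \<le> n \<Longrightarrow> sets (F m) \<subseteq> sets (F n)"
  unfolding sets_F by (rule sigma_sets_mono') (use order_trans in blast)

lemma X_measurable_F: "i \<le> n \<Longrightarrow> X i \<in> measurable (F n) E"
proof (rule measurableI)
  fix A assume "i \<le> n" "A \<in> sets E"
  then show "X i -` A \<inter> space (F n) \<in> sets (F n)"
    unfolding space_F sets_F by (intro sigma_sets.Basic) auto
qed (simp add: space_F measurable_space[OF X_measurable])

lemma borel_measurable_F_mono:
  "Z \<in> borel_measurable (F m) \<Longrightarrow> m \<le> n \<Longrightarrow> Z \<in> borel_measurable (F n)"
  using F_mono[of m n] by (auto simp: measurable_def space_F)

lemma sigma_finite_subalgebra_F: "sigma_finite_subalgebra M (F n)"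
  by (intro finite_measure_subalgebra_is_sigma_finite finite_measure_subalgebra.intro
      finite_measure_subalgebra_axioms.intro subalgebra_F finite_measure_axioms)

section \<open>From one-step transition probabilities to conditional expectations\<close>

lemma cond_prob_Suc:
  assumes "A \<in> sets E"
  shows "AE \<omega> in M. real_cond_exp M (F n) (\<lambda>\<omega>. indicator A (X (Suc n) \<omega>)) \<omega> = measure (\<kappa> (X n \<omega>)) A"
  using chain assms unfolding homogeneous_markov_chain_def by auto

text \<open>The definition of the chain speaks of \<open>real_cond_exp\<close> of indicators only.
  Testing against \<open>D\<close> and passing to nonnegative integrals gives a form that is stable
  under monotone limits.\<close>

lemma nn_integral_Suc_indicator:
  assumes D: "D \<in> sets (F n)" and A [measurable]: "A \<in> sets E"
  shows "(\<integral>\<^sup>+\<omega>\<in>D. indicator A (X (Suc n) \<omega>) \<partial>M) = (\<integral>\<^sup>+\<omega>\<in>D. emeasure (\<kappa> (X n \<omega>)) A \<partial>M)"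
proof -
  interpret F: sigma_finite_subalgebra M "F n" by (rule sigma_finite_subalgebra_F)
  have DM [measurable]: "D \<in> sets M"
    using subalgebra_F D unfolding subalgebra_def by blast
  have int: "integrable M (\<lambda>\<omega>. indicator D \<omega> * indicator A (X (Suc n) \<omega>) :: real)"
    by (rule integrable_const_bound[of _ 1]) (auto simp: indicator_def)
  have mk: "(\<lambda>\<omega>. measure (\<kappa> (X n \<omega>)) A) \<in> borel_measurable M"
    by measurable
  have DF: "(indicator D :: _ \<Rightarrow> real) \<in> borel_measurable (F n)" 
    using D by simp
  have AM: "(\<lambda>\<omega>. indicator A (X (Suc n) \<omega>) :: real) \<in> borel_measurable M" by measurable
  have intc: "integrable M (\<lambda>\<omega>. indicator D \<omega> * real_cond_exp M (F n) (\<lambda>\<omega>. indicator A (X (Suc n) \<omega>)) \<omega>)"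
    by (rule F.real_cond_exp_intg(1)[OF int DF AM])
  have ae: "AE \<omega> in M. indicator D \<omega> * real_cond_exp M (F n) (\<lambda>\<omega>. indicator A (X (Suc n) \<omega>)) \<omega>
      = indicator D \<omega> * measure (\<kappa> (X n \<omega>)) A"
    using cond_prob_Suc[OF A, of n] by eventually_elim simp
  have "(\<integral>\<^sup>+\<omega>\<in>D. indicator A (X (Suc n) \<omega>) \<partial>M)
      = (\<integral>\<^sup>+\<omega>. ennreal (indicator D \<omega> * indicator A (X (Suc n) \<omega>)) \<partial>M)"
    by (intro nn_integral_cong) (auto simp: indicator_def)
  also have "\<dots> = ennreal (\<integral>\<omega>. indicator D \<omega> * indicator A (X (Suc n) \<omega>) \<partial>M)"
    using int by (intro nn_integral_eq_integral) auto
  also have "\<dots> = ennreal (\<integral>\<omega>. indicator D \<omega> * real_cond_exp M (F n) (\<lambda>\<omega>. indicator A (X (Suc n) \<omega>)) \<omega> \<partial>M)"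
    by (simp add: F.real_cond_exp_intg(2)[OF int DF AM])
  also have "\<dots> = ennreal (\<integral>\<omega>. indicator D \<omega> * measure (\<kappa> (X n \<omega>)) A \<partial>M)"
    using ae mk by (intro arg_cong[where f=ennreal] integral_cong_AE) auto
  also have "\<dots> = (\<integral>\<^sup>+\<omega>. ennreal (indicator D \<omega> * measure (\<kappa> (X n \<omega>)) A) \<partial>M)"
  proof (rule nn_integral_eq_integral[symmetric])
    show "integrable M (\<lambda>\<omega>. indicator D \<omega> * measure (\<kappa> (X n \<omega>)) A)"
      using integrable_cong_AE_imp[OF intc _ ae] mk by auto
  qed auto
  also have "\<dots> = (\<integral>\<^sup>+\<omega>\<in>D. emeasure (\<kappa> (X n \<omega>)) A \<partial>M)"
  proof (intro nn_integral_cong)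
    fix \<omega> assume "\<omega> \<in> space M"
    then interpret k: prob_space "\<kappa> (X n \<omega>)"
      by (intro kernel measurable_space[OF X_measurable])
    show "ennreal (indicator D \<omega> * measure (\<kappa> (X n \<omega>)) A) = emeasure (\<kappa> (X n \<omega>)) A * indicator D \<omega>"
      by (auto simp: indicator_def k.emeasure_eq_measure)
  qed
  finally show ?thesis .
qed

text \<open>Induction from indicators to nonnegative measurable functions. \<open>\<kappa> x\<close>
  is known to carry the sets of \<open>E\<close> only for \<open>x \<in> space E\<close>, so each
  identity inside the kernel is proved for \<open>\<omega> \<in> space M\<close>.\<close>

lemma nn_integral_Suc:
  assumes D: "D \<in> sets (F n)" and f: "f \<in> borel_measurable E"
  shows "(\<integral>\<^sup>+\<omega>\<in>D. f (X (Suc n) \<omega>) \<partial>M) = (\<integral>\<^sup>+\<omega>\<in>D. (\<integral>\<^sup>+y. f y \<partial>\<kappa> (X n \<omega>)) \<partial>M)"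
  using f
proof (induction rule: borel_measurable_induct)
  case (cong f g)
  have "(\<integral>\<^sup>+y. f y \<partial>\<kappa> (X n \<omega>)) = (\<integral>\<^sup>+y. g y \<partial>\<kappa> (X n \<omega>))" if "\<omega> \<in> space M" for \<omega>
    using that cong(3) sets_eq_imp_space_eq[OF kernel(2)[OF measurable_space[OF X_measurable]]]
    by (intro nn_integral_cong) auto
  moreover have "f (X (Suc n) \<omega>) = g (X (Suc n) \<omega>)" if "\<omega> \<in> space M" for \<omega>
    using that cong(3) measurable_space[OF X_measurable] by auto
  ultimately show ?case using cong(4) by (simp cong: nn_integral_cong)
next
  case (set A)
  have "(\<integral>\<^sup>+y. indicator A y \<partial>\<kappa> (X n \<omega>)) = emeasure (\<kappa> (X n \<omega>)) A" if "\<omega> \<in> space M" for \<omega>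
    using that set kernel(2)[OF measurable_space[OF X_measurable]] by auto
  then show ?case using nn_integral_Suc_indicator[OF D set] by (simp cong: nn_integral_cong)
next
  case (mult u c)
  note [measurable] = mult(2)
  have DM [measurable]: "D \<in> sets M"
    using subalgebra_F D unfolding subalgebra_def by blast
  have eq: "(\<integral>\<^sup>+y. c * u y \<partial>\<kappa> (X n \<omega>)) = c * (\<integral>\<^sup>+y. u y \<partial>\<kappa> (X n \<omega>))" if "\<omega> \<in> space M" for \<omega>
    using that mult(2) kernel(2)[OF measurable_space[OF X_measurable]]
    by (intro nn_integral_cmult) (auto cong: measurable_cong_sets)
  have "(\<integral>\<^sup>+\<omega>\<in>D. c * u (X (Suc n) \<omega>) \<partial>M) = c * (\<integral>\<^sup>+\<omega>\<in>D. u (X (Suc n) \<omega>) \<partial>M)"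
    by (subst nn_integral_cmult[symmetric]) (auto simp: mult.assoc)
  also have "\<dots> = c * (\<integral>\<^sup>+\<omega>\<in>D. (\<integral>\<^sup>+y. u y \<partial>\<kappa> (X n \<omega>)) \<partial>M)"
    by (simp only: mult)
  also have "\<dots> = (\<integral>\<^sup>+\<omega>\<in>D. c * (\<integral>\<^sup>+y. u y \<partial>\<kappa> (X n \<omega>)) \<partial>M)"
    by (subst nn_integral_cmult[symmetric]) (auto simp: mult.assoc)
  finally show ?case using eq by (simp cong: nn_integral_cong)
next
  case (add u v)
  have [measurable]: "u \<in> borel_measurable E" "v \<in> borel_measurable E"
    using add by auto
  have DM [measurable]: "D \<in> sets M"
    using subalgebra_F D unfolding subalgebra_def by blast
  have eq: "(\<integral>\<^sup>+y. v y + u y \<partial>\<kappa> (X n \<omega>)) = (\<integral>\<^sup>+y. v y \<partial>\<kappa> (X n \<omega>)) + (\<integral>\<^sup>+y. u y \<partial>\<kappa> (X n \<omega>))"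
    if "\<omega> \<in> space M" for \<omega>
    using that add kernel(2)[OF measurable_space[OF X_measurable]]
    by (intro nn_integral_add) (auto cong: measurable_cong_sets)
  have "(\<integral>\<^sup>+\<omega>\<in>D. v (X (Suc n) \<omega>) + u (X (Suc n) \<omega>) \<partial>M)
      = (\<integral>\<^sup>+\<omega>\<in>D. v (X (Suc n) \<omega>) \<partial>M) + (\<integral>\<^sup>+\<omega>\<in>D. u (X (Suc n) \<omega>) \<partial>M)"
    by (subst nn_integral_add[symmetric]) (auto simp: distrib_right)
  also have "\<dots> = (\<integral>\<^sup>+\<omega>\<in>D. (\<integral>\<^sup>+y. v y \<partial>\<kappa> (X n \<omega>)) \<partial>M) + (\<integral>\<^sup>+\<omega>\<in>D. (\<integral>\<^sup>+y. u y \<partial>\<kappa> (X n \<omega>)) \<partial>M)"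
    by (simp only: add)
  also have "\<dots> = (\<integral>\<^sup>+\<omega>\<in>D. (\<integral>\<^sup>+y. v y \<partial>\<kappa> (X n \<omega>)) + (\<integral>\<^sup>+y. u y \<partial>\<kappa> (X n \<omega>)) \<partial>M)"
    by (subst nn_integral_add[symmetric]) (auto simp: distrib_right)
  finally show ?case using eq by (simp cong: nn_integral_cong)
next
  case (seq U)
  note [measurable] = seq(1)
  have DM [measurable]: "D \<in> sets M"
    using subalgebra_F D unfolding subalgebra_def by blast
  have eq: "(\<integral>\<^sup>+y. (SUP i. U i y) \<partial>\<kappa> (X n \<omega>)) = (SUP i. \<integral>\<^sup>+y. U i y \<partial>\<kappa> (X n \<omega>))"
    if "\<omega> \<in> space M" for \<omega>
    using that seq kernel(2)[OF measurable_space[OF X_measurable]]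
    by (intro nn_integral_monotone_convergence_SUP) (auto cong: measurable_cong_sets)
  have mono: "incseq (\<lambda>i \<omega>. (\<integral>\<^sup>+y. U i y \<partial>\<kappa> (X n \<omega>)) * indicator D \<omega>)"
    using seq(3) by (auto simp: incseq_def le_fun_def intro!: mult_right_mono nn_integral_mono)
  have "(\<integral>\<^sup>+\<omega>\<in>D. (SUP i. U i) (X (Suc n) \<omega>) \<partial>M) = (\<integral>\<^sup>+\<omega>. (SUP i. U i (X (Suc n) \<omega>) * indicator D \<omega>) \<partial>M)"
    by (intro nn_integral_cong) (auto simp: SUP_mult_right_ennreal image_comp indicator_def)
  also have "\<dots> = (SUP i. \<integral>\<^sup>+\<omega>\<in>D. U i (X (Suc n) \<omega>) \<partial>M)"
    using seq(3) by (intro nn_integral_monotone_convergence_SUP)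
      (auto simp: incseq_def le_fun_def intro!: mult_right_mono)
  also have "\<dots> = (SUP i. \<integral>\<^sup>+\<omega>\<in>D. (\<integral>\<^sup>+y. U i y \<partial>\<kappa> (X n \<omega>)) \<partial>M)"
    by (simp only: seq)
  also have "\<dots> = (\<integral>\<^sup>+\<omega>. (SUP i. (\<integral>\<^sup>+y. U i y \<partial>\<kappa> (X n \<omega>)) * indicator D \<omega>) \<partial>M)"
    using mono by (intro nn_integral_monotone_convergence_SUP[symmetric]) auto
  also have "\<dots> = (\<integral>\<^sup>+\<omega>\<in>D. (\<integral>\<^sup>+y. (SUP i. U i) y \<partial>\<kappa> (X n \<omega>)) \<partial>M)"
    using eq by (intro nn_integral_cong) (auto simp: image_comp indicator_def)
  finally show ?case .
qed

text \<open>Testing the transition law on the whole space shows that one step turns the marginal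
  \<nu> into \<open>\<nu> \<bind> \<kappa>\<close>, which is \<nu> by stationarity.\<close>

lemma distr_X: "distr M E (X n) = \<nu>"
proof (induction n)
  case (Suc n)
  show ?case
  proof (rule measure_eqI)
    fix A assume "A \<in> sets (distr M E (X (Suc n)))"
    then have A [measurable]: "A \<in> sets E" by simp
    have top: "space M \<in> sets (F n)" using space_F sets.top by metis
    have "emeasure (distr M E (X (Suc n))) A = (\<integral>\<^sup>+\<omega>\<in>space M. indicator A (X (Suc n) \<omega>) \<partial>M)"
    proof -
      have "emeasure (distr M E (X (Suc n))) A = (\<integral>\<^sup>+x. indicator A x \<partial>distr M E (X (Suc n)))"
        by simp
      also have "\<dots> = (\<integral>\<^sup>+\<omega>. indicator A (X (Suc n) \<omega>) \<partial>M)"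
        by (rule nn_integral_distr) measurable
      finally show ?thesis by (simp cong: nn_integral_cong)
    qed
    also have "\<dots> = (\<integral>\<^sup>+\<omega>. emeasure (\<kappa> (X n \<omega>)) A \<partial>M)"
      unfolding nn_integral_Suc_indicator[OF top A] by (simp cong: nn_integral_cong)
    also have "\<dots> = (\<integral>\<^sup>+x. emeasure (\<kappa> x) A \<partial>distr M E (X n))"
      by (rule nn_integral_distr[symmetric]) measurable
    also have "\<dots> = emeasure (\<nu> \<bind> \<kappa>) A"
    proof -
      have "\<kappa> \<in> measurable \<nu> (subprob_algebra E)" by measurable
      then show ?thesis unfolding Suc using emeasure_bind[OF \<nu>.not_empty _ A] by auto
    qed
    also have "\<nu> \<bind> \<kappa> = \<nu>"
      using stationary unfolding stationary_distribution_def by auto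
    finally show "emeasure (distr M E (X (Suc n))) A = emeasure \<nu> A" .
  qed (simp add: sets_\<nu>)
qed (rule initial)

lemma integrable_X_iff:
  fixes f :: "'a \<Rightarrow> real"
  assumes "f \<in> borel_measurable \<nu>"
  shows "integrable M (\<lambda>\<omega>. f (X n \<omega>)) \<longleftrightarrow> integrable \<nu> f"
  unfolding distr_X[of n, symmetric]
  using assms sets_\<nu> by (intro integrable_distr_eq[symmetric]) (auto cong: measurable_cong_sets)

lemma integral_X:
  fixes f :: "'a \<Rightarrow> real"
  assumes "f \<in> borel_measurable \<nu>"
  shows "(\<integral>\<omega>. f (X n \<omega>) \<partial>M) = (\<integral>x. f x \<partial>\<nu>)"
  unfolding distr_X[of n, symmetric]
  using assms sets_\<nu> by (intro integral_distr[symmetric]) (auto cong: measurable_cong_sets)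

text \<open>\<open>nn_integral_Suc\<close> is the characterising property of a conditional
  expectation, and the candidate is measurable for \<open>F n\<close> because it depends on
  \<open>X n\<close> alone.\<close>

lemma nn_cond_exp_Suc:
  assumes f [measurable]: "f \<in> borel_measurable E"
  shows "AE \<omega> in M. (\<integral>\<^sup>+y. f y \<partial>\<kappa> (X n \<omega>)) = nn_cond_exp M (F n) (\<lambda>\<omega>. f (X (Suc n) \<omega>)) \<omega>"
proof -
  interpret F: sigma_finite_subalgebra M "F n" by (rule sigma_finite_subalgebra_F)
  have X [measurable]: "X n \<in> measurable (F n) E" by (rule X_measurable_F) simp
  have "(\<lambda>x. \<integral>\<^sup>+y. f y \<partial>\<kappa> x) \<in> borel_measurable E" by measurable
  from measurable_compose[OF X this] show ?thesis
    by (intro F.nn_cond_exp_charact nn_integral_Suc f measurable_compose[OF X_measurable f]) auto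
qed

text \<open>\<open>real_cond_exp\<close> is built from the positive and negative parts, and so is
  the Bochner integral defining \<open>P f\<close>, provided it exists; the parts then match by
  \<open>nn_cond_exp_Suc\<close>.\<close>

lemma real_cond_exp_Suc:
  assumes f: "integrable \<nu> f"
  shows "AE \<omega> in M. real_cond_exp M (F n) (\<lambda>\<omega>. f (X (Suc n) \<omega>)) \<omega> = P f (X n \<omega>)"
proof -
  have fE [measurable]: "f \<in> borel_measurable E"
    using borel_measurable_integrable[OF f] sets_\<nu> by (auto cong: measurable_cong_sets)
  have top: "space M \<in> sets (F n)" using space_F sets.top by metis
  have "integrable M (\<lambda>\<omega>. f (X (Suc n) \<omega>))"
    using f by (subst integrable_X_iff) auto
  then have "(\<integral>\<^sup>+\<omega>\<in>space M. ennreal (norm (f (X (Suc n) \<omega>))) \<partial>M) < \<infinity>"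
    by (simp add: integrable_iff_bounded cong: nn_integral_cong)
  also have "(\<integral>\<^sup>+\<omega>\<in>space M. ennreal (norm (f (X (Suc n) \<omega>))) \<partial>M)
      = (\<integral>\<^sup>+\<omega>. (\<integral>\<^sup>+y. ennreal (norm (f y)) \<partial>\<kappa> (X n \<omega>)) \<partial>M)"
    by (subst nn_integral_Suc[OF top, of "\<lambda>x. ennreal (norm (f x))"]) (auto cong: nn_integral_cong)
  \<comment> \<open>This makes \<open>f\<close> integrable under
    \<open>\<kappa> (X n \<omega>)\<close> for almost every \<open>\<omega>\<close>; otherwise
    \<open>P f\<close> would be the default value 0 of the integral rather than a difference of two
    parts.\<close>
  finally have fin: "AE \<omega> in M. (\<integral>\<^sup>+y. ennreal (norm (f y)) \<partial>\<kappa> (X n \<omega>)) \<noteq> \<infinity>"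
    by (intro nn_integral_PInf_AE) (auto simp: less_top)
  have pos: "AE \<omega> in M. (\<integral>\<^sup>+y. ennreal (f y) \<partial>\<kappa> (X n \<omega>)) = nn_cond_exp M (F n) (\<lambda>\<omega>. ennreal (f (X (Suc n) \<omega>))) \<omega>"
    by (intro nn_cond_exp_Suc) measurable
  have neg: "AE \<omega> in M. (\<integral>\<^sup>+y. ennreal (- f y) \<partial>\<kappa> (X n \<omega>)) = nn_cond_exp M (F n) (\<lambda>\<omega>. ennreal (- f (X (Suc n) \<omega>))) \<omega>"
    by (intro nn_cond_exp_Suc) measurable
  show ?thesis
    using pos neg fin AE_space
  proof eventually_elim
    case (elim \<omega>)
    have "f \<in> borel_measurable (\<kappa> (X n \<omega>))"
      using fE kernel(2)[OF measurable_space[OF X_measurable elim(4)]] by (auto cong: measurable_cong_sets)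
    then have "integrable (\<kappa> (X n \<omega>)) f"
      using elim(3) by (auto simp: integrable_iff_bounded less_top)
    then show ?case
      unfolding markov_operator_def real_cond_exp_def
      by (subst real_lebesgue_integral_def) (auto simp: elim(1,2)[symmetric])
  qed
qed

text \<open>Integrability is asked of the product, not boundedness of \<open>Z\<close>, because
  \<open>Z\<close> will be a product of unbounded values of the observable. It is also returned for
  the new product, so that the step can be iterated.\<close>

lemma markov_property_Suc:
  assumes Z: "Z \<in> borel_measurable (F n)" and f: "integrable \<nu> f"
    and Pf: "P f \<in> borel_measurable \<nu>"
    and int: "integrable M (\<lambda>\<omega>. Z \<omega> * f (X (Suc n) \<omega>))"
  shows "integrable M (\<lambda>\<omega>. Z \<omega> * P f (X n \<omega>))"
    and "(\<integral>\<omega>. Z \<omega> * f (X (Suc n) \<omega>) \<partial>M) = (\<integral>\<omega>. Z \<omega> * P f (X n \<omega>) \<partial>M)"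
proof -
  interpret F: sigma_finite_subalgebra M "F n" by (rule sigma_finite_subalgebra_F)
  have [measurable]: "f \<in> borel_measurable E" "P f \<in> borel_measurable E"
    using borel_measurable_integrable[OF f] Pf sets_\<nu> by (auto cong: measurable_cong_sets)
  have ZM [measurable]: "Z \<in> borel_measurable M"
    using Z subalgebra_F measurable_from_subalg by blast
  have fM: "(\<lambda>\<omega>. f (X (Suc n) \<omega>)) \<in> borel_measurable M" by measurable
  have ae: "AE \<omega> in M. Z \<omega> * real_cond_exp M (F n) (\<lambda>\<omega>. f (X (Suc n) \<omega>)) \<omega> = Z \<omega> * P f (X n \<omega>)"
    using real_cond_exp_Suc[OF f, of n] by eventually_elim simp
  show "integrable M (\<lambda>\<omega>. Z \<omega> * P f (X n \<omega>))"
    using integrable_cong_AE_imp[OF F.real_cond_exp_intg(1)[OF int Z fM] _ ae] by auto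
  show "(\<integral>\<omega>. Z \<omega> * f (X (Suc n) \<omega>) \<partial>M) = (\<integral>\<omega>. Z \<omega> * P f (X n \<omega>) \<partial>M)"
    unfolding F.real_cond_exp_intg(2)[OF int Z fM, symmetric]
    using ae by (intro integral_cong_AE) auto
qed

text \<open>The last time step is removed first: \<open>Z\<close> is also measurable for
  \<open>F (n + k)\<close>, and the induction continues with \<open>P f\<close> in place of
  \<open>f\<close>.\<close>

lemma markov_property:
  assumes Z: "Z \<in> borel_measurable (F n)"
    and f: "\<And>j. integrable \<nu> ((P ^^ j) f)"
    and int: "integrable M (\<lambda>\<omega>. Z \<omega> * f (X (n + k) \<omega>))"
  shows "integrable M (\<lambda>\<omega>. Z \<omega> * (P ^^ k) f (X n \<omega>))
    \<and> (\<integral>\<omega>. Z \<omega> * f (X (n + k) \<omega>) \<partial>M) = (\<integral>\<omega>. Z \<omega> * (P ^^ k) f (X n \<omega>) \<partial>M)"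
  using f int
proof (induction k arbitrary: f)
  case (Suc k)
  have Z': "Z \<in> borel_measurable (F (n + k))"
    using Z by (rule borel_measurable_F_mono) simp
  have "integrable \<nu> f" "integrable \<nu> (P f)" using Suc.prems(1)[of 0] Suc.prems(1)[of 1] by auto
  note step = markov_property_Suc[OF Z' this(1) borel_measurable_integrable[OF this(2)]]
  have "integrable \<nu> ((P ^^ j) (P f))" for j
    using Suc.prems(1)[of "Suc j"] by (simp only: funpow_Suc_right o_apply)
  from Suc.IH[OF this] show ?case
    using step Suc.prems(2) by (simp add: funpow_swap1)
qed simp

end

section \<open>Correlations under geometric ergodicity\<close>

text \<open>\<open>D\<close> bounds the inclusion of \<open>B\<close> into \<open>L^p\<close>,
  \<open>c\<close> and \<theta> describe the spectral gap, and \<open>C\<close> bounds squares, that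
  is the case \<open>n = 0\<close> of the multiplicative hypothesis.\<close>

locale ergodic_chain = stationary_chain M E \<kappa> X \<nu>
  for M :: "'w measure" and E :: "'a measure" and \<kappa> X \<nu> +
  fixes B :: "('a \<Rightarrow> real) set" and nrm :: "('a \<Rightarrow> real) \<Rightarrow> real"
    and p q :: ennreal and C D c \<theta> :: real
  assumes B: "banach_function_space \<nu> B nrm"
    and one_in_B: "(\<lambda>x. 1) \<in> B"
    and P_in_B: "f \<in> B \<Longrightarrow> markov_operator \<kappa> f \<in> B"
    and conjugate: "1 \<le> p" "1 \<le> q" "1 / p + 1 / q = 1"
    and B_subset: "B \<subseteq> Lspace \<nu> p"
    and Lnorm_le: "f \<in> B \<Longrightarrow> Lnorm \<nu> p f \<le> D * nrm f" and D_pos: "0 < D"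
    and square_in_B: "f \<in> B \<Longrightarrow> (\<lambda>x. f x * f x) \<in> B"
    and nrm_square: "f \<in> B \<Longrightarrow> nrm (\<lambda>x. f x * f x) \<le> C * nrm f * nrm f" and C_pos: "0 < C"
    and decay: "f \<in> B \<Longrightarrow>
      nrm (\<lambda>x. (markov_operator \<kappa> ^^ n) f x - (\<integral>y. f y \<partial>\<nu>)) \<le> c * \<theta> ^ n * nrm f"
    and c_pos: "0 < c" and \<theta>: "0 < \<theta>" "\<theta> < 1"
begin

section \<open>The space \<open>B\<close> as a normed algebra up to a constant\<close>

lemma B_add: "f \<in> B \<Longrightarrow> g \<in> B \<Longrightarrow> (\<lambda>x. f x + g x) \<in> B"
  and B_scale: "f \<in> B \<Longrightarrow> (\<lambda>x. r * f x) \<in> B"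
  and nrm_nonneg: "f \<in> B \<Longrightarrow> 0 \<le> nrm f"
  and nrm_add: "f \<in> B \<Longrightarrow> g \<in> B \<Longrightarrow> nrm (\<lambda>x. f x + g x) \<le> nrm f + nrm g"
  and nrm_scale: "f \<in> B \<Longrightarrow> nrm (\<lambda>x. r * f x) = \<bar>r\<bar> * nrm f"
  and B_measurable: "f \<in> B \<Longrightarrow> f \<in> borel_measurable \<nu>"
  using B unfolding banach_function_space_def by blast+

lemma B_const: "(\<lambda>x. r) \<in> B"
  using B_scale[OF one_in_B, of r] by simp

lemma B_diff: "f \<in> B \<Longrightarrow> g \<in> B \<Longrightarrow> (\<lambda>x. f x - g x) \<in> B"
  using B_add[of f "\<lambda>x. - 1 * g x"] B_scale[of g "- 1"] by simp

lemma B_integrable: "f \<in> B \<Longrightarrow> integrable \<nu> f"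
  using \<nu>.Lspace_mono[of f p 1] B_subset conjugate(1) by (auto simp: Lspace_1)

lemma funpow_P_in_B: "f \<in> B \<Longrightarrow> (P ^^ n) f \<in> B"
  by (induction n) (auto intro: P_in_B)

lemma B_mult:
  assumes "f \<in> B" "g \<in> B"
  shows "(\<lambda>x. f x * g x) \<in> B"
proof -
  have "(\<lambda>x. (1 / 2) * ((f x + g x) * (f x + g x) - f x * f x - g x * g x)) \<in> B"
    by (intro B_scale B_diff square_in_B B_add assms)
  also have "(\<lambda>x. (1 / 2) * ((f x + g x) * (f x + g x) - f x * f x - g x * g x)) = (\<lambda>x. f x * g x)"
    by (auto simp: algebra_simps)
  finally show ?thesis .
qed

text \<open>In the polarisation identity the squares of \<open>f + g\<close>, \<open>f\<close> and
  \<open>g\<close> cost \<open>4 * C\<close>, \<open>C\<close> and \<open>C\<close>, and half of the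
  total is \<open>3 * C\<close>. Without normalisation the identity yields squares of the two norms
  instead of their product, so the bilinear bound is obtained from the unit ball by scaling.\<close>

lemma nrm_mult_unit:
  assumes fg: "f \<in> B" "g \<in> B" and le: "nrm f \<le> 1" "nrm g \<le> 1"
  shows "nrm (\<lambda>x. f x * g x) \<le> 3 * C"
proof -
  have sq: "nrm (\<lambda>x. h x * h x) \<le> C * r * r" if "h \<in> B" "nrm h \<le> r" for h r
  proof -
    have "C * nrm h * nrm h \<le> C * r * r"
      using that nrm_nonneg[OF that(1)] C_pos by (intro mult_mono) auto
    with nrm_square[OF that(1)] show ?thesis by linarith
  qed
  let ?s = "\<lambda>x. (f x + g x) * (f x + g x)" and ?f = "\<lambda>x. - 1 * (f x * f x)" and ?g = "\<lambda>x. - 1 * (g x * g x)"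
  have B: "(\<lambda>x. f x + g x) \<in> B" "?s \<in> B" "?f \<in> B" "?g \<in> B" "(\<lambda>x. ?s x + ?f x) \<in> B"
    by (intro B_scale square_in_B B_add fg)+
  have "2 * nrm (\<lambda>x. f x * g x) = nrm (\<lambda>x. 2 * (f x * g x))"
    using nrm_scale[OF B_mult[OF fg], of 2] by simp
  also have "(\<lambda>x. 2 * (f x * g x)) = (\<lambda>x. ?s x + ?f x + ?g x)"
    by (auto simp: algebra_simps)
  also have "nrm \<dots> \<le> nrm ?s + nrm ?f + nrm ?g"
    using nrm_add[OF B(5,4)] nrm_add[OF B(2,3)] by linarith
  also have "\<dots> = nrm ?s + nrm (\<lambda>x. f x * f x) + nrm (\<lambda>x. g x * g x)"
    by (subst (1 2) nrm_scale) (auto intro: square_in_B fg)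
  also have "\<dots> \<le> C * 2 * 2 + C * 1 * 1 + C * 1 * 1"
    using nrm_add[OF fg] le by (intro add_mono sq fg B(1)) auto
  finally show ?thesis by simp
qed

lemma nrm_mult:
  assumes fg: "f \<in> B" "g \<in> B"
  shows "nrm (\<lambda>x. f x * g x) \<le> 3 * C * nrm f * nrm g"
proof -
  have le: "nrm (\<lambda>x. f x * g x) \<le> 3 * C * (nrm f + \<delta>) * (nrm g + \<delta>)" if \<delta>: "0 < \<delta>" for \<delta>
  proof -
    \<comment> \<open>\<open>nrm f\<close> may vanish, so normalise by slightly more.\<close>
    define a b where "a = nrm f + \<delta>" and "b = nrm g + \<delta>"
    have pos: "0 < a" "0 < b" using nrm_nonneg fg \<delta> by (auto simp: a_def b_def add_nonneg_pos)
    let ?f = "\<lambda>x. (1 / a) * f x" and ?g = "\<lambda>x. (1 / b) * g x"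
    have "nrm ?f \<le> 1" "nrm ?g \<le> 1"
      unfolding nrm_scale[OF fg(1)] nrm_scale[OF fg(2)] using pos \<delta> by (auto simp: a_def b_def)
    then have "nrm (\<lambda>x. ?f x * ?g x) \<le> 3 * C"
      by (intro nrm_mult_unit B_scale fg)
    also have "(\<lambda>x. ?f x * ?g x) = (\<lambda>x. (1 / (a * b)) * (f x * g x))" by auto
    finally have "nrm (\<lambda>x. f x * g x) / (a * b) \<le> 3 * C"
      using pos unfolding nrm_scale[OF B_mult[OF fg]] by simp
    then have "nrm (\<lambda>x. f x * g x) \<le> 3 * C * (a * b)" using pos by (subst (asm) pos_divide_le_eq) auto
    then show ?thesis by (simp only: a_def b_def mult.assoc)
  qed
  have "((\<lambda>\<delta>. 3 * C * (nrm f + \<delta>) * (nrm g + \<delta>)) \<longlongrightarrow> 3 * C * (nrm f + 0) * (nrm g + 0)) (at_right 0)"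
    by (intro tendsto_intros)
  from tendsto_lowerbound[OF this, of "nrm (\<lambda>x. f x * g x)"] show ?thesis
    using le by (auto simp: eventually_at_right_less eventually_at_filter)
qed

section \<open>Pairing of the observable with members of \<open>B\<close>\<close>

lemma integral_mult_bound:
  assumes \<phi>: "\<phi> \<in> Lspace \<nu> q" and f: "f \<in> B"
  shows "integrable \<nu> (\<lambda>x. \<phi> x * f x)"
    and "\<bar>\<integral>x. \<phi> x * f x \<partial>\<nu>\<bar> \<le> D * Lnorm \<nu> q \<phi> * nrm f"
proof -
  have fp: "f \<in> Lspace \<nu> p" using f B_subset by auto
  note H = Holder_Lnorm[OF conjugate \<phi> fp]
  show "integrable \<nu> (\<lambda>x. \<phi> x * f x)" using H by simp
  have "Lnorm \<nu> q \<phi> * Lnorm \<nu> p f \<le> Lnorm \<nu> q \<phi> * (D * nrm f)"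
    by (intro mult_left_mono Lnorm_le f Lnorm_nonneg)
  then show "\<bar>\<integral>x. \<phi> x * f x \<partial>\<nu>\<bar> \<le> D * Lnorm \<nu> q \<phi> * nrm f"
    using H by (simp add: mult_ac)
qed

text \<open>Since \<phi> is centred, subtracting the constant \<open>m\<close> from
  \<open>(P ^^ n) f\<close> leaves the integral unchanged, and the difference is small in
  \<open>B\<close>.\<close>

lemma integral_mult_funpow_P_bound:
  assumes \<phi>: "\<phi> \<in> Lspace \<nu> q" "\<phi> \<in> B" "(\<integral>x. \<phi> x \<partial>\<nu>) = 0" and f: "f \<in> B"
  shows "\<bar>\<integral>x. \<phi> x * (P ^^ n) f x \<partial>\<nu>\<bar> \<le> D * c * Lnorm \<nu> q \<phi> * \<theta> ^ n * nrm f"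
proof -
  define m where "m = (\<integral>x. f x \<partial>\<nu>)"
  have uB: "(\<lambda>x. (P ^^ n) f x - m) \<in> B"
    by (intro B_diff funpow_P_in_B f B_const)
  note u = integral_mult_bound[OF \<phi>(1) uB]
  have "(\<integral>x. \<phi> x * (P ^^ n) f x \<partial>\<nu>) = (\<integral>x. \<phi> x * ((P ^^ n) f x - m) + m * \<phi> x \<partial>\<nu>)"
    by (simp add: algebra_simps)
  also have "\<dots> = (\<integral>x. \<phi> x * ((P ^^ n) f x - m) \<partial>\<nu>)"
    using u(1) B_integrable[OF \<phi>(2)] \<phi>(3) by (subst Bochner_Integration.integral_add) auto
  finally have "\<bar>\<integral>x. \<phi> x * (P ^^ n) f x \<partial>\<nu>\<bar> \<le> D * Lnorm \<nu> q \<phi> * nrm (\<lambda>x. (P ^^ n) f x - m)"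
    using u(2) by simp
  also have "\<dots> \<le> D * Lnorm \<nu> q \<phi> * (c * \<theta> ^ n * nrm f)"
    using decay[OF f, of n] D_pos unfolding m_def
    by (intro mult_left_mono mult_nonneg_nonneg Lnorm_nonneg) auto
  finally show ?thesis by (simp add: mult_ac)
qed

lemma markov_property_B:
  assumes Z: "Z \<in> borel_measurable (F m)" and f: "f \<in> B" and mn: "m \<le> n"
    and int: "integrable M (\<lambda>\<omega>. Z \<omega> * f (X n \<omega>))"
  shows "integrable M (\<lambda>\<omega>. Z \<omega> * (P ^^ (n - m)) f (X m \<omega>))"
    and "(\<integral>\<omega>. Z \<omega> * f (X n \<omega>) \<partial>M) = (\<integral>\<omega>. Z \<omega> * (P ^^ (n - m)) f (X m \<omega>) \<partial>M)"
proof -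
  have "integrable \<nu> ((P ^^ j) f)" for j by (intro B_integrable funpow_P_in_B f)
  from markov_property[OF Z this, of "n - m"] int mn
  show "integrable M (\<lambda>\<omega>. Z \<omega> * (P ^^ (n - m)) f (X m \<omega>))"
    and "(\<integral>\<omega>. Z \<omega> * f (X n \<omega>) \<partial>M) = (\<integral>\<omega>. Z \<omega> * (P ^^ (n - m)) f (X m \<omega>) \<partial>M)"
    by auto
qed

lemma B_X_measurable_F:
  assumes "f \<in> B" "i \<le> n"
  shows "(\<lambda>\<omega>. f (X i \<omega>)) \<in> borel_measurable (F n)"
  using measurable_compose[OF X_measurable_F[OF assms(2)], of f borel] B_measurable[OF assms(1)] sets_\<nu>
  by (auto cong: measurable_cong_sets)

end

text \<open>\<open>'b\<close> is the type of states. Membership in \<open>L^4\<close> controls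
  products of four values, membership in \<open>L^q\<close> allows the pairing with
  \<open>B\<close>.\<close>

locale centered_observable = ergodic_chain +
  fixes \<phi> :: "'b \<Rightarrow> real"
  assumes \<phi>_in_B: "\<phi> \<in> B"
    and centered: "(\<integral>x. \<phi> x \<partial>\<nu>) = 0"
    and \<phi>_L4: "\<phi> \<in> Lspace \<nu> 4"
    and \<phi>_Lq: "\<phi> \<in> Lspace \<nu> q"
begin

abbreviation "Y i \<omega> \<equiv> \<phi> (X i \<omega>)"

text \<open>As \<phi> is centred, this is the covariance of two values at distance \<open>k\<close>;
  writing it through \<open>P\<close> makes it visibly independent of the position in time.\<close>

definition "cov k = (\<integral>x. \<phi> x * (P ^^ k) \<phi> x \<partial>\<nu>)"

lemma \<phi>_measurable [measurable]: "\<phi> \<in> borel_measurable E"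
  using B_measurable[OF \<phi>_in_B] sets_\<nu> by (auto cong: measurable_cong_sets)

lemma Y_measurable [measurable]: "Y i \<in> borel_measurable M"
  by measurable

lemma integrable_\<phi>4: "integrable \<nu> (\<lambda>x. \<phi> x ^ 4)"
proof -
  have "enn2real 4 = 4" by (simp flip: ennreal_numeral)
  then have "integrable \<nu> (\<lambda>x. \<bar>\<phi> x\<bar> powr 4)" using \<phi>_L4 by (simp add: Lspace_def)
  also have "(\<lambda>x. \<bar>\<phi> x\<bar> powr 4) = (\<lambda>x. \<phi> x ^ 4)"
  proof
    show "\<bar>\<phi> x\<bar> powr 4 = \<phi> x ^ 4" for x
      by (cases "\<phi> x = 0") (simp_all add: powr_numeral)
  qed
  finally show ?thesis .
qed

lemma integrable_\<phi>2: "integrable \<nu> (\<lambda>x. \<phi> x ^ 2)"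
proof (rule Bochner_Integration.integrable_bound[of _ "\<lambda>x. 1 + \<phi> x ^ 4"])
  \<comment> \<open>Nonnegativity of \<open>(r ^ 2 - 1 / 2) ^ 2\<close> gives even
    \<open>r ^ 2 \<le> r ^ 4 + 1 / 4\<close>.\<close>
  have "r ^ 2 \<le> 1 + r ^ 4" for r :: real
    using sum_power2_ge_zero[of "r ^ 2 - 1 / 2" 0] by (simp add: power2_eq_square algebra_simps eval_nat_numeral)
  then show "AE x in \<nu>. norm (\<phi> x ^ 2) \<le> norm (1 + \<phi> x ^ 4)" by auto
qed (use integrable_\<phi>4 in auto)

lemma integrable_Y4: "integrable M (\<lambda>\<omega>. Y i \<omega> ^ 4)"
  and integral_Y4: "(\<integral>\<omega>. Y i \<omega> ^ 4 \<partial>M) = (\<integral>x. \<phi> x ^ 4 \<partial>\<nu>)"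
  and integrable_Y2: "integrable M (\<lambda>\<omega>. Y i \<omega> ^ 2)"
  and integral_Y2: "(\<integral>\<omega>. Y i \<omega> ^ 2 \<partial>M) = (\<integral>x. \<phi> x ^ 2 \<partial>\<nu>)"
  using integrable_X_iff[of "\<lambda>x. \<phi> x ^ 4"] integral_X[of "\<lambda>x. \<phi> x ^ 4"] integrable_\<phi>4
    integrable_X_iff[of "\<lambda>x. \<phi> x ^ 2"] integral_X[of "\<lambda>x. \<phi> x ^ 2"] integrable_\<phi>2
  by (auto dest: borel_measurable_integrable)

lemma integrable_YY: "integrable M (\<lambda>\<omega>. Y a \<omega> * Y b \<omega>)"
  and abs_integral_YY: "\<bar>\<integral>\<omega>. Y a \<omega> * Y b \<omega> \<partial>M\<bar> \<le> (\<integral>x. \<phi> x ^ 2 \<partial>\<nu>)"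
proof -
  have le: "\<bar>x * y\<bar> \<le> (x ^ 2 + y ^ 2) / 2" for x y :: real
    using sum_squares_bound[of "\<bar>x\<bar>" "\<bar>y\<bar>"] by (simp add: abs_mult)
  show int: "integrable M (\<lambda>\<omega>. Y a \<omega> * Y b \<omega>)"
    by (rule Bochner_Integration.integrable_bound[of _ "\<lambda>\<omega>. (Y a \<omega> ^ 2 + Y b \<omega> ^ 2) / 2"])
      (use le in \<open>auto intro!: integrable_Y2\<close>)
  have "\<bar>\<integral>\<omega>. Y a \<omega> * Y b \<omega> \<partial>M\<bar> \<le> (\<integral>\<omega>. \<bar>Y a \<omega> * Y b \<omega>\<bar> \<partial>M)" by (rule integral_abs_bound)
  also have "\<dots> \<le> (\<integral>\<omega>. (Y a \<omega> ^ 2 + Y b \<omega> ^ 2) / 2 \<partial>M)"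
    using int le by (intro integral_mono) (auto intro!: integrable_Y2)
  also have "\<dots> = (\<integral>x. \<phi> x ^ 2 \<partial>\<nu>)"
    by (simp add: integrable_Y2 integral_Y2)
  finally show "\<bar>\<integral>\<omega>. Y a \<omega> * Y b \<omega> \<partial>M\<bar> \<le> (\<integral>x. \<phi> x ^ 2 \<partial>\<nu>)" .
qed

text \<open>Two rounds of the arithmetic-geometric mean inequality give the average of four fourth
  powers, all with the same integral by stationarity. The name \<open>c'\<close> avoids the decay
  constant \<open>c\<close>.\<close>

lemma integrable_YYYY: "integrable M (\<lambda>\<omega>. Y a \<omega> * Y b \<omega> * Y c' \<omega> * Y d \<omega>)"
  and abs_integral_YYYY: "\<bar>\<integral>\<omega>. Y a \<omega> * Y b \<omega> * Y c' \<omega> * Y d \<omega> \<partial>M\<bar> \<le> (\<integral>x. \<phi> x ^ 4 \<partial>\<nu>)"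
proof -
  have le: "\<bar>x * y * z * w\<bar> \<le> (x ^ 4 + y ^ 4 + z ^ 4 + w ^ 4) / 4" for x y z w :: real
  proof -
    have two: "\<bar>r * s\<bar> \<le> (r ^ 2 + s ^ 2) / 2" for r s :: real
      using sum_squares_bound[of "\<bar>r\<bar>" "\<bar>s\<bar>"] by (simp add: abs_mult)
    have sq: "(r * s) ^ 2 \<le> (r ^ 4 + s ^ 4) / 2" for r s :: real
      using two[of "r ^ 2" "s ^ 2"] by (simp add: power_mult_distrib flip: power_mult)
    show ?thesis using two[of "x * y" "z * w"] sq[of x y] sq[of z w] by (simp add: mult.assoc)
  qed
  let ?b = "\<lambda>\<omega>. (Y a \<omega> ^ 4 + Y b \<omega> ^ 4 + Y c' \<omega> ^ 4 + Y d \<omega> ^ 4) / 4"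
  have b: "integrable M ?b"
    by (intro integrable_divide_zero Bochner_Integration.integrable_add integrable_Y4)
  show int: "integrable M (\<lambda>\<omega>. Y a \<omega> * Y b \<omega> * Y c' \<omega> * Y d \<omega>)"
    by (rule Bochner_Integration.integrable_bound[OF b]) (use le in \<open>auto intro!: AE_I2\<close>)
  have "\<bar>\<integral>\<omega>. Y a \<omega> * Y b \<omega> * Y c' \<omega> * Y d \<omega> \<partial>M\<bar> \<le> (\<integral>\<omega>. \<bar>Y a \<omega> * Y b \<omega> * Y c' \<omega> * Y d \<omega>\<bar> \<partial>M)"
    by (rule integral_abs_bound)
  also have "\<dots> \<le> (\<integral>\<omega>. ?b \<omega> \<partial>M)"
    using int le b by (intro integral_mono) auto
  also have "\<dots> = (\<integral>x. \<phi> x ^ 4 \<partial>\<nu>)"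
    by (simp add: integrable_Y4 integral_Y4)
  finally show "\<bar>\<integral>\<omega>. Y a \<omega> * Y b \<omega> * Y c' \<omega> * Y d \<omega> \<partial>M\<bar> \<le> (\<integral>x. \<phi> x ^ 4 \<partial>\<nu>)" .
qed

text \<open>Conditioning at time \<open>a\<close> turns the expectation into a single integral
  against \<nu>, to which the decay estimate for centred \<phi> applies.\<close>

lemma integral_Y_bound:
  assumes f: "f \<in> B" and ab: "a \<le> b" and int: "integrable M (\<lambda>\<omega>. Y a \<omega> * f (X b \<omega>))"
  shows "(\<integral>\<omega>. Y a \<omega> * f (X b \<omega>) \<partial>M) = (\<integral>x. \<phi> x * (P ^^ (b - a)) f x \<partial>\<nu>)"
    and "\<bar>\<integral>\<omega>. Y a \<omega> * f (X b \<omega>) \<partial>M\<bar> \<le> D * c * Lnorm \<nu> q \<phi> * \<theta> ^ (b - a) * nrm f"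
proof -
  have "(\<integral>\<omega>. Y a \<omega> * f (X b \<omega>) \<partial>M) = (\<integral>\<omega>. Y a \<omega> * (P ^^ (b - a)) f (X a \<omega>) \<partial>M)"
    by (intro markov_property_B B_X_measurable_F \<phi>_in_B f ab int order_refl)
  also have "\<dots> = (\<integral>x. \<phi> x * (P ^^ (b - a)) f x \<partial>\<nu>)"
    by (intro integral_X[of "\<lambda>x. \<phi> x * (P ^^ (b - a)) f x"] borel_measurable_times B_measurable funpow_P_in_B \<phi>_in_B f)
  finally show eq: "(\<integral>\<omega>. Y a \<omega> * f (X b \<omega>) \<partial>M) = (\<integral>x. \<phi> x * (P ^^ (b - a)) f x \<partial>\<nu>)" .
  show "\<bar>\<integral>\<omega>. Y a \<omega> * f (X b \<omega>) \<partial>M\<bar> \<le> D * c * Lnorm \<nu> q \<phi> * \<theta> ^ (b - a) * nrm f"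
    unfolding eq by (intro integral_mult_funpow_P_bound \<phi>_Lq \<phi>_in_B centered f)
qed

lemma integral_YY: "a \<le> b \<Longrightarrow> (\<integral>\<omega>. Y a \<omega> * Y b \<omega> \<partial>M) = cov (b - a)"
  unfolding cov_def by (intro integral_Y_bound \<phi>_in_B integrable_YY)

lemma abs_cov_le: "\<bar>cov k\<bar> \<le> (\<integral>x. \<phi> x ^ 2 \<partial>\<nu>)"
  using abs_integral_YY[of 0 k] by (simp add: integral_YY)

lemma abs_cov_le_geometric: "\<bar>cov k\<bar> \<le> D * c * Lnorm \<nu> q \<phi> * \<theta> ^ k * nrm \<phi>"
  using integral_Y_bound(2)[OF \<phi>_in_B _ integrable_YY, of 0 k] by (simp add: integral_YY)

lemma nrm_funpow_P_\<phi>: "nrm ((P ^^ n) \<phi>) \<le> c * \<theta> ^ n * nrm \<phi>"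
  using decay[OF \<phi>_in_B, of n] centered by simp

text \<open>By the Markov property the left-hand integral is \<open>\<integral>\<phi> P\<^sup>i(\<phi> P\<^sup>j g)\<close> with \<open>g = \<phi> P\<^sup>k \<phi>\<close>,
  where \<open>i\<close>, \<open>j\<close>, \<open>k\<close> are the gaps. Removing
  the mean \<open>cov k\<close> of \<open>g\<close> costs \<open>cov i * cov k\<close>, and what is left decays in all three gaps.\<close>

lemma abs_integral_YYYY_diff_le:
  assumes abcd: "a \<le> b" "b \<le> c'" "c' \<le> d"
  shows "\<bar>(\<integral>\<omega>. Y a \<omega> * Y b \<omega> * Y c' \<omega> * Y d \<omega> \<partial>M) - cov (b - a) * cov (d - c')\<bar>
    \<le> 9 * D * C\<^sup>2 * c ^ 3 * Lnorm \<nu> q \<phi> * nrm \<phi> ^ 3 * \<theta> ^ (b - a + (c' - b) + (d - c'))"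
proof -
  define i j k where "i = b - a" and "j = c' - b" and "k = d - c'"
  let ?e = "nrm \<phi>"
  have e: "0 \<le> ?e" by (rule nrm_nonneg[OF \<phi>_in_B])
  define g where "g = (\<lambda>x. \<phi> x * (P ^^ k) \<phi> x)"
  define u where "u = (\<lambda>x. \<phi> x * ((P ^^ j) g x - cov k))"
  have gB: "g \<in> B" unfolding g_def by (intro B_mult funpow_P_in_B \<phi>_in_B)
  have vB: "(\<lambda>x. (P ^^ j) g x - cov k) \<in> B" by (intro B_diff funpow_P_in_B B_const gB)
  have uB: "u \<in> B" unfolding u_def by (intro B_mult \<phi>_in_B vB)
  have nn: "0 \<le> 3 * C * ?e" "0 \<le> c * \<theta> ^ j" using C_pos e c_pos \<theta> by auto
  have "nrm g \<le> 3 * C * ?e * nrm ((P ^^ k) \<phi>)"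
    unfolding g_def by (intro nrm_mult funpow_P_in_B \<phi>_in_B)
  also have "\<dots> \<le> 3 * C * ?e * (c * \<theta> ^ k * ?e)"
    using nn by (intro mult_left_mono nrm_funpow_P_\<phi>) auto
  finally have g: "nrm g \<le> 3 * C * ?e * (c * \<theta> ^ k * ?e)" .
  have "nrm u \<le> 3 * C * ?e * nrm (\<lambda>x. (P ^^ j) g x - cov k)"
    unfolding u_def by (intro nrm_mult \<phi>_in_B vB)
  \<comment> \<open>\<open>cov k\<close> is by definition the mean of \<open>g\<close>, so the
    spectral gap applies to the difference.\<close>
  also have "\<dots> \<le> 3 * C * ?e * (c * \<theta> ^ j * nrm g)"
    using decay[OF gB, of j] nn by (intro mult_left_mono) (auto simp: g_def cov_def)
  also have "\<dots> \<le> 3 * C * ?e * (c * \<theta> ^ j * (3 * C * ?e * (c * \<theta> ^ k * ?e)))"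
    using nn by (intro mult_left_mono g) auto
  finally have u: "nrm u \<le> 3 * C * ?e * (c * \<theta> ^ j * (3 * C * ?e * (c * \<theta> ^ k * ?e)))" .

  \<comment> \<open>Conditioning proceeds from the latest time backwards. Each use of the Markov
    property also returns integrability of the new integrand, which the next use requires;
    \<open>int1'\<close> merely absorbs the value at \<open>c'\<close> into
    \<open>g\<close>.\<close>
  have int1: "integrable M (\<lambda>\<omega>. (Y a \<omega> * Y b \<omega> * Y c' \<omega>) * (P ^^ k) \<phi> (X c' \<omega>))"
    and eq1: "(\<integral>\<omega>. (Y a \<omega> * Y b \<omega> * Y c' \<omega>) * Y d \<omega> \<partial>M) = (\<integral>\<omega>. (Y a \<omega> * Y b \<omega> * Y c' \<omega>) * (P ^^ k) \<phi> (X c' \<omega>) \<partial>M)"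
    unfolding k_def using abcd integrable_YYYY
    by (intro markov_property_B borel_measurable_times B_X_measurable_F \<phi>_in_B; simp)+
  have int1': "integrable M (\<lambda>\<omega>. (Y a \<omega> * Y b \<omega>) * g (X c' \<omega>))"
    using int1 by (simp add: g_def mult_ac)
  have int2: "integrable M (\<lambda>\<omega>. (Y a \<omega> * Y b \<omega>) * (P ^^ j) g (X b \<omega>))"
    and eq2: "(\<integral>\<omega>. (Y a \<omega> * Y b \<omega>) * g (X c' \<omega>) \<partial>M) = (\<integral>\<omega>. (Y a \<omega> * Y b \<omega>) * (P ^^ j) g (X b \<omega>) \<partial>M)"
    unfolding j_def using abcd int1'
    by (intro markov_property_B borel_measurable_times B_X_measurable_F \<phi>_in_B gB; simp)+
  have ueq: "Y a \<omega> * u (X b \<omega>) = (Y a \<omega> * Y b \<omega>) * (P ^^ j) g (X b \<omega>) - cov k * (Y a \<omega> * Y b \<omega>)" for \<omega>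
    by (simp add: u_def algebra_simps)
  have int3: "integrable M (\<lambda>\<omega>. Y a \<omega> * u (X b \<omega>))"
    unfolding ueq using int2 integrable_YY by auto
  have "(\<integral>\<omega>. Y a \<omega> * u (X b \<omega>) \<partial>M) = (\<integral>\<omega>. (Y a \<omega> * Y b \<omega>) * (P ^^ j) g (X b \<omega>) \<partial>M) - cov k * cov i"
    unfolding ueq using int2 integrable_YY integral_YY[OF abcd(1)] by (simp add: i_def)
  also have "(\<integral>\<omega>. (Y a \<omega> * Y b \<omega>) * (P ^^ j) g (X b \<omega>) \<partial>M) = (\<integral>\<omega>. Y a \<omega> * Y b \<omega> * Y c' \<omega> * Y d \<omega> \<partial>M)"
    unfolding eq1 eq2[symmetric] by (simp add: g_def mult_ac)
  finally have "\<bar>(\<integral>\<omega>. Y a \<omega> * Y b \<omega> * Y c' \<omega> * Y d \<omega> \<partial>M) - cov i * cov k\<bar>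
      \<le> D * c * Lnorm \<nu> q \<phi> * \<theta> ^ i * nrm u"
    using integral_Y_bound(2)[OF uB abcd(1) int3] by (simp add: i_def mult.commute)
  also have "\<dots> \<le> D * c * Lnorm \<nu> q \<phi> * \<theta> ^ i * (3 * C * ?e * (c * \<theta> ^ j * (3 * C * ?e * (c * \<theta> ^ k * ?e))))"
    using D_pos c_pos \<theta> by (intro mult_left_mono u mult_nonneg_nonneg Lnorm_nonneg) auto
  \<comment> \<open>Two products contribute \<open>(3 * C)\<^sup>2\<close>, three uses of the
    spectral gap \<open>c ^ 3\<close>, and the final pairing \<open>D\<close>.\<close>
  also have "\<dots> = 9 * D * C\<^sup>2 * c ^ 3 * Lnorm \<nu> q \<phi> * ?e ^ 3 * \<theta> ^ (i + j + k)"
    by (simp add: power_add power2_eq_square power3_eq_cube)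
  finally show ?thesis by (simp add: i_def j_def k_def)
qed

text \<open>\<open>N\<close> is left free, since its best value depends on
  \<open>nrm \<phi>\<close>. The square comes from the covariances at the first and last gap, the
  other bracket from the truncated remainder.\<close>

lemma fourth_moment_bound:
  fixes N :: nat
  shows "(\<integral>\<omega>. (\<Sum>i=1..n. Y i \<omega>) ^ 4 \<partial>M) \<le> 24 * real n *
    (real n * (real N * (\<integral>x. \<phi> x ^ 2 \<partial>\<nu>) + D * c * Lnorm \<nu> q \<phi> * nrm \<phi> * \<theta> ^ N / (1 - \<theta>)) ^ 2
     + (real N ^ 3 * (\<integral>x. \<phi> x ^ 4 \<partial>\<nu>)
       + 3 * (9 * D * C\<^sup>2 * c ^ 3 * Lnorm \<nu> q \<phi> * nrm \<phi> ^ 3) * \<theta> ^ N / (1 - \<theta>) ^ 3))"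
proof -
  define m2 where "m2 = (\<integral>x. \<phi> x ^ 2 \<partial>\<nu>)"
  define m4 where "m4 = (\<integral>x. \<phi> x ^ 4 \<partial>\<nu>)"
  define \<alpha> where "\<alpha> = D * c * Lnorm \<nu> q \<phi> * nrm \<phi>"
  define \<beta> where "\<beta> = 9 * D * C\<^sup>2 * c ^ 3 * Lnorm \<nu> q \<phi> * nrm \<phi> ^ 3"
  have nn: "0 \<le> m2" "0 \<le> m4" "0 \<le> \<alpha>" "0 \<le> \<beta>"
    using D_pos C_pos c_pos nrm_nonneg[OF \<phi>_in_B] Lnorm_nonneg[of \<nu> q \<phi>]
    by (auto simp: m2_def m4_def \<alpha>_def \<beta>_def intro!: integral_nonneg mult_nonneg_nonneg)
  define Q where "Q a b d e = (\<integral>\<omega>. Y a \<omega> * Y b \<omega> * Y d \<omega> * Y e \<omega> \<partial>M)" for a b d e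
  define R where "R i j k = (if i < N \<and> j < N \<and> k < N then m4 else \<beta> * \<theta> ^ (i + j + k))" for i j k :: nat
  define H where "H i j k = \<bar>cov i\<bar> * \<bar>cov k\<bar> + R i j k" for i j k
  have QH: "\<bar>Q a b d e\<bar> \<le> H (b - a) (d - b) (e - d)" if "a \<le> b" "b \<le> d" "d \<le> e" for a b d e
  proof -
    let ?v = "cov (b - a) * cov (e - d)"
    have "\<bar>Q a b d e - ?v\<bar> \<le> \<beta> * \<theta> ^ (b - a + (d - b) + (e - d))"
      using abs_integral_YYYY_diff_le[OF that] by (simp add: Q_def \<beta>_def)
    then have "\<bar>Q a b d e\<bar> \<le> \<bar>?v\<bar> + \<beta> * \<theta> ^ (b - a + (d - b) + (e - d))" by linarith
    \<comment> \<open>The trivial bound contains no covariances; adding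
      \<open>\<bar>?v\<bar>\<close> brings both cases into the common form \<open>H\<close>, a
      function of the gaps alone.\<close>
    moreover have "\<bar>Q a b d e\<bar> \<le> m4"
      unfolding Q_def m4_def by (rule abs_integral_YYYY)
    then have "\<bar>Q a b d e\<bar> \<le> \<bar>?v\<bar> + m4" by linarith
    ultimately show ?thesis by (simp add: H_def R_def abs_mult)
  qed
  have "(\<Sum>i=1..n. Y i \<omega>) ^ 4 = (\<Sum>a=1..n. \<Sum>b=1..n. \<Sum>d=1..n. \<Sum>e=1..n. Y a \<omega> * Y b \<omega> * Y d \<omega> * Y e \<omega>)" for \<omega>
    by (simp only: power4_eq_xxxx sum_distrib_left[symmetric] sum_distrib_right[symmetric])
  then have "(\<integral>\<omega>. (\<Sum>i=1..n. Y i \<omega>) ^ 4 \<partial>M) = (\<Sum>a=1..n. \<Sum>b=1..n. \<Sum>d=1..n. \<Sum>e=1..n. Q a b d e)"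
    by (simp add: Q_def Bochner_Integration.integral_sum integrable_YYYY)
  also have "\<dots> \<le> (\<Sum>a=1..n. \<Sum>b=1..n. \<Sum>d=1..n. \<Sum>e=1..n. \<bar>Q a b d e\<bar>)"
    by (intro sum_mono) auto
  also have "\<dots> \<le> 24 * (\<Sum>e=1..n. \<Sum>d=1..e. \<Sum>b=1..d. \<Sum>a=1..b. \<bar>Q a b d e\<bar>)"
    by (rule sum_le_24_sum_ordered) (auto simp: Q_def mult_ac)
  also have "\<dots> \<le> 24 * (\<Sum>e=1..n. \<Sum>d=1..e. \<Sum>b=1..d. \<Sum>a=1..b. H (b - a) (d - b) (e - d))"
    by (intro mult_left_mono sum_mono QH) auto
  also have "\<dots> \<le> 24 * (real n * (\<Sum>k<n. \<Sum>j<n. \<Sum>i<n. H i j k))"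
    using nn \<theta> by (intro mult_left_mono sum_gaps_le) (auto simp: H_def R_def)
  \<comment> \<open>The middle gap \<open>j\<close> is absent from the covariance product, so its
    sum is a plain factor \<open>n\<close>.\<close>
  also have "(\<Sum>k<n. \<Sum>j<n. \<Sum>i<n. H i j k) = real n * (\<Sum>i<n. \<bar>cov i\<bar>) ^ 2 + (\<Sum>k<n. \<Sum>j<n. \<Sum>i<n. R i j k)"
  proof -
    have "(\<Sum>k<n. \<Sum>j<n. \<Sum>i<n. \<bar>cov i\<bar> * \<bar>cov k\<bar>) = real n * (\<Sum>i<n. \<bar>cov i\<bar>) ^ 2"
      by (simp add: power2_eq_square sum_distrib_left[symmetric] sum_distrib_right[symmetric])
    then show ?thesis by (simp add: H_def sum.distrib)
  qed
  also have "24 * (real n * \<dots>) \<le> 24 * (real n * (real n * (real N * m2 + \<alpha> * \<theta> ^ N / (1 - \<theta>)) ^ 2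
      + (real N ^ 3 * m4 + 3 * \<beta> * \<theta> ^ N / (1 - \<theta>) ^ 3)))"
  proof (intro mult_left_mono add_mono power_mono)
    have "(\<Sum>i<n. \<bar>cov i\<bar>) \<le> (\<Sum>i<n. if i < N then m2 else \<alpha> * \<theta> ^ i)"
      using abs_cov_le abs_cov_le_geometric by (intro sum_mono) (auto simp: m2_def \<alpha>_def mult_ac)
    also have "\<dots> \<le> real N * m2 + \<alpha> * \<theta> ^ N / (1 - \<theta>)"
      using nn by (intro sum_truncated_geometric_le \<theta>)
    finally show "(\<Sum>i<n. \<bar>cov i\<bar>) \<le> real N * m2 + \<alpha> * \<theta> ^ N / (1 - \<theta>)" .
    show "(\<Sum>k<n. \<Sum>j<n. \<Sum>i<n. R i j k) \<le> real N ^ 3 * m4 + 3 * \<beta> * \<theta> ^ N / (1 - \<theta>) ^ 3"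
      unfolding R_def using nn by (intro sum3_truncated_geometric_le \<theta>) auto
  qed (auto simp: sum_nonneg)
  finally show ?thesis
    by (simp add: m2_def m4_def \<alpha>_def \<beta>_def mult.assoc)
qed

end

section \<open>Choice of the cutoff and of a uniform constant\<close>

theorem theorem1:
  fixes M :: "'w measure" and E :: "'a measure" and \<kappa> :: "'a \<Rightarrow> 'a measure"
    and X :: "nat \<Rightarrow> 'w \<Rightarrow> 'a" and \<nu> :: "'a measure"
    and B :: "('a \<Rightarrow> real) set" and nrm :: "('a \<Rightarrow> real) \<Rightarrow> real"
    and p q :: ennreal and C :: real
  assumes "homogeneous_markov_chain M E \<kappa> X"
    and "stationary_distribution E \<kappa> \<nu>"
    and "distr M E (X 0) = \<nu>"
    and "banach_function_space \<nu> B nrm"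
    and "(\<lambda>x. 1) \<in> B"
    and "\<And>f. f \<in> B \<Longrightarrow> markov_operator \<kappa> f \<in> B"
    and "geometrically_ergodic \<kappa> \<nu> B nrm"
    and "1 \<le> p" and "continuously_included \<nu> B nrm p"
    and "1 \<le> q" and "1 / p + 1 / q = 1"
    and "C > 0"
    and "\<And>f n. f \<in> B \<Longrightarrow> (\<lambda>x. f x * (markov_operator \<kappa> ^^ n) f x) \<in> B"
    and "\<And>f n. f \<in> B \<Longrightarrow>
           nrm (\<lambda>x. f x * (markov_operator \<kappa> ^^ n) f x) \<le> C * nrm f * nrm ((markov_operator \<kappa> ^^ n) f)"
  shows "\<exists>K::real. \<forall>\<phi>\<in>B. (\<integral>x. \<phi> x \<partial>\<nu>) = 0 \<and> \<phi> \<in> Lspace \<nu> 4 \<and> \<phi> \<in> Lspace \<nu> (3 * q) \<longrightarrow>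
    (\<forall>n\<ge>1. (\<integral>\<omega>. (\<Sum>i=1..n. \<phi> (X i \<omega>)) ^ 4 \<partial>M) \<le> K *
      (real n * Lnorm \<nu> 1 (\<lambda>x. \<phi> x ^ 4) * ln (nrm \<phi> + 1) ^ 3
       + real n * (Lnorm \<nu> q (\<lambda>x. \<phi> x ^ 3) + Lnorm \<nu> q (\<lambda>x. \<phi> x ^ 2) + Lnorm \<nu> q \<phi>
                   + (Lnorm \<nu> q \<phi>) ^ 2) * ln (nrm \<phi> + 1) ^ 2
       + (real n) ^ 2 * (Lnorm \<nu> 1 (\<lambda>x. \<phi> x ^ 2) * ln (nrm \<phi> + 1) + Lnorm \<nu> q \<phi>) ^ 2))"
proof -
  have stat: "stationary_chain M E \<kappa> X \<nu>"
    using assms(1-3) by unfold_locales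
  obtain c \<theta> where c: "0 < c" "0 < \<theta>" "\<theta> < 1"
    and decay: "\<And>f n. f \<in> B \<Longrightarrow>
      nrm (\<lambda>x. (markov_operator \<kappa> ^^ n) f x - (\<integral>y. f y \<partial>\<nu>)) \<le> c * \<theta> ^ n * nrm f"
    using assms(7) unfolding geometrically_ergodic_def by blast
  obtain D where D: "0 < D" "\<And>f. f \<in> B \<Longrightarrow> Lnorm \<nu> p f \<le> D * nrm f" and sub: "B \<subseteq> Lspace \<nu> p"
    using assms(9) unfolding continuously_included_def by blast
  interpret ergodic_chain M E \<kappa> X \<nu> B nrm p q C D c \<theta>
  proof (rule ergodic_chain.intro[OF stat], unfold_locales)
    show "\<And>f. f \<in> B \<Longrightarrow> (\<lambda>x. f x * f x) \<in> B" using assms(13)[where n = 0] by simp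
    show "\<And>f. f \<in> B \<Longrightarrow> nrm (\<lambda>x. f x * f x) \<le> C * nrm f * nrm f" using assms(14)[where n = 0] by simp
  qed (use assms c decay D sub in auto)
  \<comment> \<open>\<open>K0\<close> is fixed before \<phi> and \<open>n\<close>; only
    \<open>N\<close> will depend on \<phi>, through its norm.\<close>
  obtain K0 where K0: "0 < K0" and cut: "\<And>\<epsilon>. 0 \<le> \<epsilon> \<Longrightarrow> \<exists>N::nat. real N \<le> K0 * ln (\<epsilon> + 1)
      \<and> \<epsilon> * \<theta> ^ N \<le> K0 \<and> \<epsilon> ^ 3 * \<theta> ^ N \<le> K0 * ln (\<epsilon> + 1) ^ 2"
    using geometric_cutoff[OF \<theta>] by blast
  \<comment> \<open>\<open>a\<close> and \<open>b\<close> collect the coefficients of the two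
    geometric tails in \<open>fourth_moment_bound\<close>; 27 is \<open>3 * 9\<close>.\<close>
  define a where "a = D * c / (1 - \<theta>)"
  define b where "b = 27 * D * C\<^sup>2 * c ^ 3 / (1 - \<theta>) ^ 3"
  \<comment> \<open>The three summands are the constants of the covariance square, of the trivial
    bound and of the geometric remainder; 24 counts the orderings.\<close>
  define K where "K = 24 * ((K0 + a * K0) ^ 2 + K0 ^ 3 + b * K0)"
  have ab: "0 \<le> a" "0 \<le> b" using D c C_pos by (auto simp: a_def b_def)
  show ?thesis
  proof (intro exI[of _ K] ballI impI allI)
    fix \<phi> and n :: nat
    assume \<phi>B: "\<phi> \<in> B"
      and *: "(\<integral>x. \<phi> x \<partial>\<nu>) = 0 \<and> \<phi> \<in> Lspace \<nu> 4 \<and> \<phi> \<in> Lspace \<nu> (3 * q)"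
    \<comment> \<open>The inequality is taken in \<open>ennreal\<close> and so covers
      \<open>q = \<infinity>\<close>.\<close>
    have "q \<le> 3 * q"
      using mult_right_mono[of 1 "3 :: ennreal" q] by simp
    then have \<phi>q: "\<phi> \<in> Lspace \<nu> q"
      using * assms(10) by (intro \<nu>.Lspace_mono[of \<phi> "3 * q" q]) auto
    interpret centered_observable M E \<kappa> X \<nu> B nrm p q C D c \<theta> \<phi>
      by unfold_locales (use * \<phi>B \<phi>q in auto)
    define W L \<epsilon> where "W = Lnorm \<nu> q \<phi>" and "L = ln (nrm \<phi> + 1)" and "\<epsilon> = nrm \<phi>"
    define m2 m4 where "m2 = (\<integral>x. \<phi> x ^ 2 \<partial>\<nu>)" and "m4 = (\<integral>x. \<phi> x ^ 4 \<partial>\<nu>)"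
    define r where "r = Lnorm \<nu> q (\<lambda>x. \<phi> x ^ 3) + Lnorm \<nu> q (\<lambda>x. \<phi> x ^ 2) + W ^ 2"
    have nn: "0 \<le> W" "0 \<le> L" "0 \<le> \<epsilon>" "0 \<le> m2" "0 \<le> m4" "0 \<le> r"
      using nrm_nonneg[OF \<phi>B] by (auto simp: W_def L_def \<epsilon>_def m2_def m4_def r_def Lnorm_nonneg)
    obtain N :: nat where N: "real N \<le> K0 * L" "\<epsilon> * \<theta> ^ N \<le> K0" "\<epsilon> ^ 3 * \<theta> ^ N \<le> K0 * L ^ 2"
      using cut[OF nn(3)] by (auto simp: L_def \<epsilon>_def)
    have norms: "Lnorm \<nu> 1 (\<lambda>x. \<phi> x ^ 4) = m4" "Lnorm \<nu> 1 (\<lambda>x. \<phi> x ^ 2) = m2"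
      by (simp_all add: Lnorm_1 m2_def m4_def)
    have 1: "(real N * m2 + a * W * (\<epsilon> * \<theta> ^ N)) ^ 2 \<le> (K0 + a * K0) ^ 2 * (m2 * L + W) ^ 2"
    proof -
      have "real N * m2 + a * W * (\<epsilon> * \<theta> ^ N) \<le> K0 * L * m2 + a * W * K0"
        using nn ab N by (intro add_mono mult_right_mono mult_left_mono) auto
      \<comment> \<open>Multiplying out the right-hand side produces both terms and, besides them,
        nonnegative cross terms.\<close>
      also have "\<dots> \<le> (K0 + a * K0) * (m2 * L + W)"
        using nn ab K0 by (simp add: algebra_simps)
      finally show ?thesis
        using nn ab \<theta> unfolding power_mult_distrib[symmetric] by (intro power_mono) auto
    qed
    have 2: "real N ^ 3 * m4 \<le> K0 ^ 3 * (m4 * L ^ 3)"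
    proof -
      have "real N ^ 3 * m4 \<le> (K0 * L) ^ 3 * m4"
        using nn N by (intro mult_right_mono power_mono) auto
      then show ?thesis by (simp add: power_mult_distrib mult_ac)
    qed
    have 3: "b * W * (\<epsilon> ^ 3 * \<theta> ^ N) \<le> b * K0 * ((r + W) * L ^ 2)"
    proof -
      have "b * W * (\<epsilon> ^ 3 * \<theta> ^ N) \<le> b * W * (K0 * L ^ 2)"
        using nn ab N by (intro mult_left_mono) auto
      also have "\<dots> = b * K0 * (W * L ^ 2)" by simp
      also have "\<dots> \<le> b * K0 * ((r + W) * L ^ 2)"
        using nn ab K0 by (intro mult_left_mono mult_right_mono) auto
      finally show ?thesis .
    qed
    have "(\<integral>\<omega>. (\<Sum>i=1..n. \<phi> (X i \<omega>)) ^ 4 \<partial>M) \<le> 24 * real n *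
        (real n * (real N * m2 + a * W * (\<epsilon> * \<theta> ^ N)) ^ 2
         + (real N ^ 3 * m4 + b * W * (\<epsilon> ^ 3 * \<theta> ^ N)))"
      using fourth_moment_bound[of n N] by (simp add: a_def b_def W_def \<epsilon>_def m2_def m4_def mult_ac)
    also have "\<dots> \<le> 24 * real n * (real n * ((K0 + a * K0) ^ 2 * (m2 * L + W) ^ 2)
         + (K0 ^ 3 * (m4 * L ^ 3) + b * K0 * ((r + W) * L ^ 2)))"
      by (intro mult_left_mono add_mono 1 2 3) auto
    also have "\<dots> \<le> K * (real n * m4 * L ^ 3 + real n * (r + W) * L ^ 2 + (real n) ^ 2 * (m2 * L + W) ^ 2)"
    proof -
      define x y z where "x = real n * (m4 * L ^ 3)" and "y = real n * ((r + W) * L ^ 2)"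
        and "z = (real n) ^ 2 * (m2 * L + W) ^ 2"
      define k1 k2 k3 where "k1 = (K0 + a * K0) ^ 2" and "k2 = K0 ^ 3" and "k3 = b * K0"
      have "0 \<le> x" "0 \<le> y" "0 \<le> z" "0 \<le> k1" "0 \<le> k2" "0 \<le> k3"
        using nn ab K0 by (auto simp: x_def y_def z_def k1_def k2_def k3_def)
      then have "24 * (k1 * z + k2 * x + k3 * y) \<le> 24 * (k1 + k2 + k3) * (x + y + z)"
        by (simp add: algebra_simps)
      then show ?thesis
        by (simp add: x_def y_def z_def k1_def k2_def k3_def K_def algebra_simps power2_eq_square[of "real n"])
    qed
    finally show "(\<integral>\<omega>. (\<Sum>i=1..n. \<phi> (X i \<omega>)) ^ 4 \<partial>M) \<le> K *
      (real n * Lnorm \<nu> 1 (\<lambda>x. \<phi> x ^ 4) * ln (nrm \<phi> + 1) ^ 3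
       + real n * (Lnorm \<nu> q (\<lambda>x. \<phi> x ^ 3) + Lnorm \<nu> q (\<lambda>x. \<phi> x ^ 2) + Lnorm \<nu> q \<phi>
                   + (Lnorm \<nu> q \<phi>) ^ 2) * ln (nrm \<phi> + 1) ^ 2
       + (real n) ^ 2 * (Lnorm \<nu> 1 (\<lambda>x. \<phi> x ^ 2) * ln (nrm \<phi> + 1) + Lnorm \<nu> q \<phi>) ^ 2)"
      unfolding norms by (simp add: r_def W_def L_def add_ac)
  qed
qed

end
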